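(* Let $\vec p=(\infty,1)$, and let $\vec a,\vec b,\vec c\in\mathbb{R}^2$, $\vec\alpha\in(-1,\infty)^2$. Then the following are equivalent: (1) $S_{\vec a,\vec b,\vec c}$ is bounded from $L^{\vec p}_{\vec\alpha}(T_B\times T_B)$ to $L^\infty(T_B\times T_B)$; (2) $T_{\vec a,\vec b,\vec c}$ is bounded from $L^{\vec p}_{\vec\alpha}(T_B\times T_B)$ to $L^\infty(T_B\times T_B)$; (3) $a_1>0$, $a_2\ge0$, $b_1>-1$, $b_2\ge\alpha_2$, $c_1=n+1+a_1+b_1$, and $c_2=a_2+b_2-\alpha_2$.
   Context: Let $n$ be a positive integer. For $z=(z_1,\dots,z_n)\in\mathbb{C}^n$ write $z=x+iy$ with $x,y\in\mathbb{R}^n$, $z'=(z_1,\dots,z_{n-1})$, $y'=(y_1,\dots,y_{n-1})$. Let $B=\{y\in\mathbb{R}^n: |y'|^2<y_n\}$ and $T_B=\{x+iy: x\in\mathbb{R}^n, y\in B\}$. For $z\in T_B$ put $\rho(z)=y_n-|y'|^2>0$, and for $z,u\in T_B$ put $\rho(z,u)=\frac14\big(\sum_{j=1}^{n-1}(z_j-\overline{u_j})^2-2i(z_n-\overline{u_n})\big)$; this has positive real part, and complex powers $\rho(z,u)^c$ are taken with the principal branch. $dV$ is Lebesgue measure on $\mathbb{C}^n$ and $dV_\alpha(z)=\rho(z)^\alpha dV(z)$. For $\vec p=(p_1,p_2)\in[1,\infty]^2$ and $\vec\alpha=(\alpha_1,\alpha_2)$, $L^{\vec p}_{\vec\alpha}(T_B\times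 T_B)$ is the space of measurable $f$ on $T_B\times T_B$ with finite mixed norm $\|f\|_{\vec p,\vec\alpha}=\big\{\int_{T_B}\big(\int_{T_B}|f(z,w)|^{p_1}dV_{\alpha_1}(z)\big)^{p_2/p_1}dV_{\alpha_2}(w)\big\}^{1/p_2}$, with the inner (resp. outer) integral replaced by an essential supremum in $z$ (resp. $w$) when $p_1=\infty$ (resp. $p_2=\infty$); in particular for $\vec p=(\infty,1)$, $\|f\|=\int_{T_B}\operatorname{ess\,sup}_{z}|f(z,w)|\,dV_{\alpha_2}(w)$. When $\vec p=(\infty,\infty)$ this is $L^\infty(T_B\times T_B)$. For $\vec a=(a_1,a_2),\vec b=(b_1,b_2),\vec c=(c_1,c_2)\in\mathbb{R}^2$, $T_{\vec a,\vec b,\vec c}f(z,w)=\rho(z)^{a_1}\rho(w)^{a_2}\int_{T_B}\int_{T_B}\frac{\rho(u)^{b_1}\rho(\eta)^{b_2}}{\rho(z,u)^{c_1}\rho(w,\eta)^{c_2}}f(u,\eta)\,dV(u)\,dV(\eta)$ and $S_{\vec a,\vec b,\vec c}f(z,w)=\rho(z)^{a_1}\rho(w)^{a_2}\int_{T_B}\int_{T_B}\frac{\rho(u)^{b_1}\rho(\eta)^{b_2}}{|\rho(z,u)|^{c_1}|\rho(w,\eta)|^{c_2}}f(u,\eta)\,dV(u)\,dV(\eta)$. An operator is bounded from $X$ to $Y$ if for every $f\in X$ the defining integral converges for a.e. $(z,w)$ and $\|Tf\|_Y\le C\|f\|_X$ with $C$ independent of $f$. *)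

theory Defs
  imports "HOL-Analysis.Analysis" "HOL-Probability.Essential_Supremum"
begin

text \<open>Points of C^n are modelled as functions nat => complex, coordinates 0..n-1;
  z' = (z 0, ..., z (n-2)), z_n = z (n-1).  Lebesgue measure on C^n is the
  product of Lebesgue(-Borel) measure on C over the index set {..<n}.\<close>

definition lebC :: "nat \<Rightarrow> (nat \<Rightarrow> complex) measure" where
  "lebC n = PiM {..<n} (\<lambda>_. (lborel :: complex measure))"

definition tube :: "nat \<Rightarrow> (nat \<Rightarrow> complex) set" where
  "tube n = {z \<in> space (lebC n). (\<Sum>j<n-1. (Im (z j))\<^sup>2) < Im (z (n-1))}"

definition rho :: "nat \<Rightarrow> (nat \<Rightarrow> complex) \<Rightarrow> real" where
  "rho n z = Im (z (n-1)) - (\<Sum>j<n-1. (Im (z j))\<^sup>2)"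

definition rho2 :: "nat \<Rightarrow> (nat \<Rightarrow> complex) \<Rightarrow> (nat \<Rightarrow> complex) \<Rightarrow> complex" where
  "rho2 n z u = (1/4) * ((\<Sum>j<n-1. (z j - cnj (u j))\<^sup>2) - 2 * \<i> * (z (n-1) - cnj (u (n-1))))"

definition dVa :: "nat \<Rightarrow> real \<Rightarrow> (nat \<Rightarrow> complex) measure" where
  "dVa n \<alpha> = density (lebC n) (\<lambda>z. indicator (tube n) z * ennreal (rho n z powr \<alpha>))"

definition mixnorm_inf1 ::
  "nat \<Rightarrow> real \<Rightarrow> real \<Rightarrow> ((nat \<Rightarrow> complex) \<times> (nat \<Rightarrow> complex) \<Rightarrow> complex) \<Rightarrow> ennreal" where
  "mixnorm_inf1 n \<alpha>1 \<alpha>2 f =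
     (\<integral>\<^sup>+ w. esssup (dVa n \<alpha>1) (\<lambda>z. ennreal (norm (f (z, w)))) \<partial>(dVa n \<alpha>2))"

definition dV2 :: "nat \<Rightarrow> ((nat \<Rightarrow> complex) \<times> (nat \<Rightarrow> complex)) measure" where
  "dV2 n = dVa n 0 \<Otimes>\<^sub>M dVa n 0"

definition intop ::
  "(('a \<times> 'a) \<Rightarrow> complex) \<Rightarrow> (('a \<times> 'a) \<Rightarrow> ('a \<times> 'a) \<Rightarrow> complex) \<Rightarrow> ('a \<times> 'a) measure
    \<Rightarrow> (('a \<times> 'a) \<Rightarrow> complex) \<Rightarrow> ('a \<times> 'a) \<Rightarrow> complex" where
  "intop P K M f x = P x * (LINT y|M. K x y * f y)"

definition bounded_inf1_to_inf ::
  "nat \<Rightarrow> real \<Rightarrow> real \<Rightarrow> (((nat \<Rightarrow> complex) \<times> (nat \<Rightarrow> complex)) \<Rightarrow> complex)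
     \<Rightarrow> (((nat \<Rightarrow> complex) \<times> (nat \<Rightarrow> complex)) \<Rightarrow> ((nat \<Rightarrow> complex) \<times> (nat \<Rightarrow> complex)) \<Rightarrow> complex)
     \<Rightarrow> bool" where
  "bounded_inf1_to_inf n \<alpha>1 \<alpha>2 P K \<longleftrightarrow>
     (\<exists>C::real. \<forall>f. f \<in> borel_measurable (lebC n \<Otimes>\<^sub>M lebC n) \<and> mixnorm_inf1 n \<alpha>1 \<alpha>2 f < \<infinity> \<longrightarrow>
        (AE x in dV2 n. integrable (dV2 n) (\<lambda>y. K x y * f y)) \<and>
        esssup (dV2 n) (\<lambda>x. ennreal (norm (intop P K (dV2 n) f x)))
          \<le> ennreal C * mixnorm_inf1 n \<alpha>1 \<alpha>2 f)"

definition prefac :: "nat \<Rightarrow> real \<Rightarrow> real \<Rightarrow> ((nat \<Rightarrow> complex) \<times> (nat \<Rightarrow> complex)) \<Rightarrow> complex" where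
  "prefac n a1 a2 = (\<lambda>(z, w). complex_of_real (rho n z powr a1 * rho n w powr a2))"

text \<open>Kernel of T_{a,b,c} (principal branch complex powers).\<close>
definition kerT :: "nat \<Rightarrow> real \<Rightarrow> real \<Rightarrow> real \<Rightarrow> real \<Rightarrow>
     ((nat \<Rightarrow> complex) \<times> (nat \<Rightarrow> complex)) \<Rightarrow> ((nat \<Rightarrow> complex) \<times> (nat \<Rightarrow> complex)) \<Rightarrow> complex" where
  "kerT n b1 b2 c1 c2 = (\<lambda>(z, w) (u, \<eta>).
     complex_of_real (rho n u powr b1 * rho n \<eta> powr b2) /
     (rho2 n z u powr complex_of_real c1 * rho2 n w \<eta> powr complex_of_real c2))"

definition kerS :: "nat \<Rightarrow> real \<Rightarrow> real \<Rightarrow> real \<Rightarrow> real \<Rightarrow>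
     ((nat \<Rightarrow> complex) \<times> (nat \<Rightarrow> complex)) \<Rightarrow> ((nat \<Rightarrow> complex) \<times> (nat \<Rightarrow> complex)) \<Rightarrow> complex" where
  "kerS n b1 b2 c1 c2 = (\<lambda>(z, w) (u, \<eta>).
     complex_of_real (rho n u powr b1 * rho n \<eta> powr b2 /
       (norm (rho2 n z u) powr c1 * norm (rho2 n w \<eta>) powr c2)))"

end

theory Submission
  imports Defs
begin

text \<open>
  Writing \<open>u = (u', s + i (|Im u'|\<^sup>2 + r))\<close> one has
  \<open>Re \<rho>(z,u) = |z' - u'|\<^sup>2/4 + (\<rho>(z) + r)/2\<close>, while \<open>Im \<rho>(z,u)\<close> is \<open>s/2\<close> up to a shift
  depending on \<open>z\<close> and \<open>u'\<close>.  Integrating in the order \<open>s\<close>, \<open>u'\<close>, \<open>r\<close> therefore gives exactly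
  \<open>\<integral> \<rho>(u)\<^sup>b |\<rho>(z,u)|\<^sup>-\<^sup>c dV(u) = H \<rho>(z)\<^sup>n\<^sup>+\<^sup>1\<^sup>+\<^sup>b\<^sup>-\<^sup>c\<close> with \<open>0 < H \<le> \<infinity>\<close>, and \<open>H < \<infinity>\<close> if and only
  if \<open>b > -1\<close> and \<open>c > n + 1 + b\<close>.  Together with \<open>|\<rho>(w,\<eta>)| \<ge> (\<rho>(w) + \<rho>(\<eta>))/2\<close> this yields
  sufficiency.  For necessity, testing on \<open>f = cnj (sgn K(x,\<cdot>))\<close> times the indicator of
  \<open>E \<times> D\<close> removes the phase of the kernel, so that both operators satisfy
  \<open>\<rho>(z)\<^sup>a\<^sup>1 \<integral> \<rho>(u)\<^sup>b\<^sup>1 |\<rho>(z,u)|\<^sup>-\<^sup>c\<^sup>1 dV(u) \<sqdot> \<rho>(w)\<^sup>a\<^sup>2 \<rho>(\<eta>)\<^sup>b\<^sup>2\<^sup>-\<^sup>\<alpha>\<^sup>2 |\<rho>(w,\<eta>)|\<^sup>-\<^sup>c\<^sup>2 \<le> C\<close>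
  for all \<open>z, w, \<eta>\<close>; the points \<open>i t e\<^sub>n\<close> then determine the exponents.
\<close>

section \<open>Scalar integrals\<close>

lemma power2_powr: "(s\<^sup>2) powr k = \<bar>s\<bar> powr (2 * k)" for s k :: real
proof -
  have "s\<^sup>2 = \<bar>s\<bar> powr 2" by simp
  then show ?thesis by (simp only: powr_powr)
qed

text \<open>The integrand is at most 1 on \<open>{-1..1}\<close> and at most
  \<open>\<bar>s\<bar> powr - k\<close> outside, where \<open>k > 1\<close> makes the tails
  converge; the left tail is the reflection of the right one.\<close>

lemma nn_integral_inverse_powr_line_finite:
  fixes k :: real
  assumes "k > 1"
  shows "(\<integral>\<^sup>+ s. ennreal ((1 + s\<^sup>2) powr (- k / 2)) \<partial>lborel) < top"
proof -
  have tail: "(\<integral>\<^sup>+ s\<in>{1..}. ennreal (s powr - k) \<partial>lborel) < top"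
  proof -
    have "((\<lambda>x. x powr - k) has_integral - (1 powr (- k + 1)) / (- k + 1)) {1..}"
      using assms by (intro has_integral_powr_to_inf) auto
    then have "((\<lambda>x. indicator {1..} x * (x powr - k)) has_integral - (1 powr (- k + 1)) / (- k + 1)) UNIV"
      by (subst (asm) has_integral_restrict_UNIV [symmetric])
         (auto elim!: has_integral_eq[rotated] simp: indicator_def)
    then have "(\<integral>\<^sup>+ x. ennreal (indicator {1..} x * (x powr - k)) \<partial>lborel) = ennreal (- (1 powr (- k + 1)) / (- k + 1))"
      by (intro nn_integral_has_integral_lborel) (auto simp: indicator_def)
    moreover have "ennreal (indicator {1..} x * (x powr - k)) = ennreal (x powr - k) * indicator {1..} x" for x
      by (simp add: indicator_def)
    ultimately show ?thesis by simp
  qed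
  have refl: "(\<integral>\<^sup>+ s. ennreal (\<bar>s\<bar> powr - k) * indicator {..-1} s \<partial>lborel)
      = (\<integral>\<^sup>+ s\<in>{1..}. ennreal (s powr - k) \<partial>lborel)"
    by (subst nn_integral_real_affine[of _ "-1" 0]) (auto simp: indicator_def intro!: nn_integral_cong)
  have "ennreal ((1 + s\<^sup>2) powr (- k / 2)) \<le> ennreal (s powr - k) * indicator {1..} s
      + (ennreal (\<bar>s\<bar> powr - k) * indicator {..-1} s + indicator {-1..1} s)" for s :: real
  proof -
    have b: "(1 + s\<^sup>2) powr (- k / 2) \<le> \<bar>s\<bar> powr - k" if "s \<noteq> 0"
    proof -
      have "(1 + s\<^sup>2) powr (- k / 2) \<le> (s\<^sup>2) powr (- k / 2)"
        using that assms by (intro powr_mono2') auto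
      also have "\<dots> = \<bar>s\<bar> powr - k"
        by (simp add: power2_powr)
      finally show ?thesis .
    qed
    have c: "(1 + s\<^sup>2) powr (- k / 2) \<le> 1"
      using assms powr_mono2'[of "-k/2" 1 "1 + s\<^sup>2"] by simp
    consider "s > 1" | "s < -1" | "s \<in> {-1..1}" by fastforce
    then show ?thesis
    proof cases
      case 1 then show ?thesis using b by (auto simp: indicator_def intro!: ennreal_leI)
    next
      case 2 then show ?thesis using b by (auto simp: indicator_def intro!: ennreal_leI)
    next
      case 3 then have "ennreal ((1 + s\<^sup>2) powr (- k / 2)) \<le> indicator {-1..1} s"
        using c by (simp add: ennreal_le_1)
      then show ?thesis by (simp add: add_increasing)
    qed
  qed
  then have "(\<integral>\<^sup>+ s. ennreal ((1 + s\<^sup>2) powr (- k / 2)) \<partial>lborel) \<le>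
     (\<integral>\<^sup>+ s. ennreal (s powr - k) * indicator {1..} s
      + (ennreal (\<bar>s\<bar> powr - k) * indicator {..-1} s + indicator {-1..1::real} s) \<partial>lborel)"
    by (intro nn_integral_mono) auto
  also have "\<dots> = (\<integral>\<^sup>+ s\<in>{1..}. ennreal (s powr - k) \<partial>lborel)
     + ((\<integral>\<^sup>+ s. ennreal (\<bar>s\<bar> powr - k) * indicator {..-1} s \<partial>lborel) + 2)"
    by (simp add: nn_integral_add)
  also have "\<dots> < top" using tail by (simp add: refl ennreal_add_less_top)
  finally show ?thesis .
qed

text \<open>Serves to keep the constants below strictly positive even when they are infinite, so
  that finiteness of a product of constants can be read off for a single factor.\<close>

lemma nn_integral_pos:
  assumes [measurable]: "f \<in> borel_measurable M" and "emeasure M A > 0" "A \<in> sets M"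
    and "\<And>x. x \<in> A \<Longrightarrow> f x > 0"
  shows "(\<integral>\<^sup>+ x. f x \<partial>M) > 0"
proof (rule ccontr)
  assume "\<not> ?thesis"
  then have "AE x in M. f x = 0"
    by (simp add: nn_integral_0_iff_AE)
  then have "AE x in M. x \<notin> A" using assms(4) by (metis (mono_tags, lifting) eventually_mono less_irrefl)
  then show False using assms(2,3) by (simp add: AE_iff_null_sets[symmetric] null_sets_def)
qed

lemma norm_Complex_powr:
  "norm (Complex t s) powr c = (t\<^sup>2 + s\<^sup>2) powr (c / 2)"
  using power2_powr[of "norm (Complex t s)" "c / 2"] by (simp add: cmod_power2)

text \<open>The substitution replacing \<open>s\<close> by \<open>a + 2 * t * s\<close> removes the
  shift \<open>a\<close> and turns the norm into \<open>t * sqrt (1 + s^2)\<close>, so that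
  \<open>t\<close> scales out. The constant \<open>B\<close> is allowed to be infinite; its
  positivity and its finiteness for \<open>c > 1\<close> are what later steps rely on.\<close>

lemma nn_integral_norm_Complex_powr:
  fixes c :: real
  obtains B :: ennreal where "B > 0" "c > 1 \<Longrightarrow> B < top"
    "\<And>t a. t > 0 \<Longrightarrow> (\<integral>\<^sup>+ s. ennreal (norm (Complex t ((s - a) / 2)) powr (- c)) \<partial>lborel)
       = B * ennreal (t powr (1 - c))"
proof
  let ?B = "2 * (\<integral>\<^sup>+ s. ennreal ((1 + s\<^sup>2) powr (- c / 2)) \<partial>lborel)"
  have "0 < (\<integral>\<^sup>+ s. ennreal ((1 + s\<^sup>2) powr (- c / 2)) \<partial>lborel)"
  proof (rule nn_integral_pos[where A = "{0..1}"])
    show "ennreal ((1 + s\<^sup>2) powr (- c / 2)) > 0" for s :: real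
      using add_pos_nonneg[of 1 "s\<^sup>2"] by auto
  qed auto
  then show "?B > 0" by (simp add: ennreal_zero_less_mult_iff)
  show "?B < top" if "c > 1"
    using nn_integral_inverse_powr_line_finite[OF that] by (simp add: ennreal_mult_less_top)
  fix t a :: real assume t: "t > 0"
  have "(\<integral>\<^sup>+ s. ennreal (norm (Complex t ((s - a) / 2)) powr (- c)) \<partial>lborel)
    = ennreal (2 * t) * (\<integral>\<^sup>+ s. ennreal (norm (Complex t (t * s)) powr (- c)) \<partial>lborel)"
    unfolding norm_Complex_powr
    by (subst nn_integral_real_affine[of _ "2 * t" a]) (use t in \<open>auto\<close>)
  also have "(\<lambda>s. ennreal (norm (Complex t (t * s)) powr (- c)))
      = (\<lambda>s. ennreal (t powr - c) * ennreal ((1 + s\<^sup>2) powr (- c / 2)))"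
  proof
    fix s
    have "norm (Complex t (t * s)) powr (- c) = (t\<^sup>2 * (1 + s\<^sup>2)) powr (- c / 2)"
      by (simp add: norm_Complex_powr power_mult_distrib algebra_simps)
    also have "\<dots> = (t\<^sup>2) powr (- c / 2) * (1 + s\<^sup>2) powr (- c / 2)"
      by (simp add: powr_mult)
    also have "(t\<^sup>2) powr (- c / 2) = t powr - c"
      using t by (simp add: power2_powr)
    finally show "ennreal (norm (Complex t (t * s)) powr (- c)) = ennreal (t powr - c) * ennreal ((1 + s\<^sup>2) powr (- c / 2))"
      by (simp add: ennreal_mult)
  qed
  also have "ennreal (2 * t) * (\<integral>\<^sup>+ s. ennreal (t powr - c) * ennreal ((1 + s\<^sup>2) powr (- c / 2)) \<partial>lborel)
     = ?B * (ennreal t * ennreal (t powr - c))"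
    using t by (simp add: nn_integral_cmult ennreal_mult ac_simps)
  also have "ennreal t * ennreal (t powr - c) = ennreal (t powr (1 - c))"
    using t by (simp add: ennreal_mult'[symmetric] powr_diff powr_minus field_simps)
  finally show "(\<integral>\<^sup>+ s. ennreal (norm (Complex t ((s - a) / 2)) powr (- c)) \<partial>lborel)
       = ?B * ennreal (t powr (1 - c))" .
qed

section \<open>Integrals over the complex plane\<close>

lemma nn_integral_lborel_complex:
  fixes f :: "complex \<Rightarrow> ennreal"
  assumes [measurable]: "f \<in> borel_measurable borel"
  shows "(\<integral>\<^sup>+ \<zeta>. f \<zeta> \<partial>lborel) = (\<integral>\<^sup>+ v. \<integral>\<^sup>+ s. f (Complex s v) \<partial>lborel \<partial>lborel)"
proof -
  have Cm[measurable]: "(\<lambda>(s, v). Complex s v) \<in> borel_measurable (lborel \<Otimes>\<^sub>M lborel)"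
    unfolding case_prod_beta Complex_eq by measurable
  \<comment> \<open>Lebesgue measure is characterized by giving each box its volume, and a box in
    the plane is the image of a product of two intervals.\<close>
  have "lborel = distr (lborel \<Otimes>\<^sub>M lborel) borel (\<lambda>(s, v). Complex s v)" (is "_ = ?M")
  proof (rule lborel_eqI)
    fix l u :: complex assume lu: "\<And>b. b \<in> Basis \<Longrightarrow> l \<bullet> b \<le> u \<bullet> b"
    have le: "Re l \<le> Re u" "Im l \<le> Im u"
      using lu[of 1] lu[of \<i>] by (auto simp: Basis_complex_def inner_complex_def)
    have eq: "(\<lambda>(s, v). Complex s v) -` box l u \<inter> space (lborel \<Otimes>\<^sub>M lborel)
        = {Re l<..<Re u} \<times> {Im l<..<Im u}"
      by (auto simp: box_def Basis_complex_def inner_complex_def space_pair_measure)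
    have "emeasure ?M (box l u) = emeasure (lborel \<Otimes>\<^sub>M lborel) ({Re l<..<Re u} \<times> {Im l<..<Im u})"
      by (subst emeasure_distr) (auto simp: eq)
    also have "\<dots> = ennreal (Re u - Re l) * ennreal (Im u - Im l)"
      using le by (subst lborel.emeasure_pair_measure_Times) auto
    finally show "emeasure ?M (box l u) = ennreal (\<Prod>b\<in>Basis. (u - l) \<bullet> b)"
      using le by (simp add: Basis_complex_def inner_complex_def ennreal_mult)
  qed simp
  then have "(\<integral>\<^sup>+ \<zeta>. f \<zeta> \<partial>lborel) = (\<integral>\<^sup>+ \<zeta>. f \<zeta> \<partial>?M)" by simp
  also have "\<dots> = (\<integral>\<^sup>+ p. f (case p of (s, v) \<Rightarrow> Complex s v) \<partial>(lborel \<Otimes>\<^sub>M lborel))"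
    by (subst nn_integral_distr) auto
  also have "\<dots> = (\<integral>\<^sup>+ v. \<integral>\<^sup>+ s. f (Complex s v) \<partial>lborel \<partial>lborel)"
    by (subst lborel_pair.nn_integral_snd[symmetric]) auto
  finally show ?thesis .
qed

lemma nn_integral_complex_affine:
  fixes f :: "complex \<Rightarrow> ennreal" and r :: real
  assumes [measurable]: "f \<in> borel_measurable borel" and "r > 0"
  shows "(\<integral>\<^sup>+ \<zeta>. f \<zeta> \<partial>lborel) = ennreal (r\<^sup>2) * (\<integral>\<^sup>+ \<zeta>. f (a + r *\<^sub>R \<zeta>) \<partial>lborel)"
  using assms(2) by (subst lborel_affine[of r a])
     (simp_all add: nn_integral_density nn_integral_distr nn_integral_cmult)

text \<open>Rescaling by \<open>2 * sqrt t\<close> around \<open>a\<close> has Jacobian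
  \<open>4 * t\<close> in real dimension two; this explains the exponent \<open>1 - k\<close> and
  the factor 4 in \<open>?A\<close>.\<close>

lemma nn_integral_complex_plane_powr:
  fixes k :: real
  obtains A :: ennreal where "A > 0" "k > 1 \<Longrightarrow> A < top"
    "\<And>t (a :: complex). t > 0 \<Longrightarrow> (\<integral>\<^sup>+ \<zeta>. ennreal ((t + (norm (a - \<zeta>))\<^sup>2 / 4) powr (- k)) \<partial>lborel)
       = A * ennreal (t powr (1 - k))"
proof
  let ?I = "\<integral>\<^sup>+ \<zeta>. ennreal ((1 + (norm (\<zeta>::complex))\<^sup>2) powr (- k)) \<partial>lborel"
  let ?A = "4 * ?I"
  have "0 < ?I"
  proof (rule nn_integral_pos[where A = "box 0 (Complex 1 1)"])
    show "ennreal ((1 + (norm s)\<^sup>2) powr (- k)) > 0" for s :: complex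
      using add_pos_nonneg[of 1 "(norm s)\<^sup>2"] by auto
    have "emeasure lborel (box 0 (Complex 1 1)) = ennreal (\<Prod>b\<in>Basis. (Complex 1 1 - 0) \<bullet> b)"
      by (rule emeasure_lborel_box) (auto simp: Basis_complex_def inner_complex_def)
    then show "emeasure lborel (box 0 (Complex 1 1)) > 0"
      by (simp add: Basis_complex_def inner_complex_def)
  qed auto
  then show "?A > 0" by (simp add: ennreal_zero_less_mult_iff)
  show "?A < top" if k: "k > 1"
  proof -
    let ?L = "\<integral>\<^sup>+ s. ennreal ((1 + s\<^sup>2) powr (- k / 2)) \<partial>lborel"
    \<comment> \<open>Both \<open>1 + v^2\<close> and \<open>1 + s^2\<close> are at most
      \<open>1 + (norm (Complex s v))^2\<close>. Giving half of the exponent to each bounds the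
      integrand by a product of two convergent line integrals, which replaces polar
      coordinates.\<close>
    have le: "ennreal ((1 + (norm (Complex s v))\<^sup>2) powr (- k)) \<le>
       ennreal ((1 + v\<^sup>2) powr (- k / 2)) * ennreal ((1 + s\<^sup>2) powr (- k / 2))" for s v
    proof -
      have "(1 + (norm (Complex s v))\<^sup>2) powr (- k) =
         (1 + (norm (Complex s v))\<^sup>2) powr (- k / 2) * (1 + (norm (Complex s v))\<^sup>2) powr (- k / 2)"
        by (simp add: powr_add[symmetric])
      also have "\<dots> \<le> (1 + v\<^sup>2) powr (- k / 2) * (1 + s\<^sup>2) powr (- k / 2)"
        using k by (intro mult_mono powr_mono2') (auto simp: cmod_power2 add_pos_nonneg)
      finally show ?thesis by (simp add: ennreal_mult'[symmetric] ennreal_leI)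
    qed
    have "?I = (\<integral>\<^sup>+ v. \<integral>\<^sup>+ s. ennreal ((1 + (norm (Complex s v))\<^sup>2) powr (- k)) \<partial>lborel \<partial>lborel)"
      by (rule nn_integral_lborel_complex) measurable
    also have "\<dots> \<le> (\<integral>\<^sup>+ v. \<integral>\<^sup>+ s. ennreal ((1 + v\<^sup>2) powr (- k / 2)) * ennreal ((1 + s\<^sup>2) powr (- k / 2)) \<partial>lborel \<partial>lborel)"
      by (intro nn_integral_mono le)
    also have "\<dots> = ?L * ?L"
      by (simp add: nn_integral_cmult nn_integral_multc)
    also have "\<dots> < top" using nn_integral_inverse_powr_line_finite[OF k] by (simp add: ennreal_mult_less_top)
    finally show ?thesis by (simp add: ennreal_mult_less_top)
  qed
  fix t :: real and a :: complex assume t: "t > 0"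
  have "(\<integral>\<^sup>+ \<zeta>. ennreal ((t + (norm (a - \<zeta>))\<^sup>2 / 4) powr (- k)) \<partial>lborel)
     = ennreal ((2 * sqrt t)\<^sup>2) * (\<integral>\<^sup>+ \<zeta>. ennreal ((t + (norm (a - (a + (2 * sqrt t) *\<^sub>R \<zeta>)))\<^sup>2 / 4) powr (- k)) \<partial>lborel)"
    using t by (intro nn_integral_complex_affine) auto
  also have "(\<lambda>\<zeta>. ennreal ((t + (norm (a - (a + (2 * sqrt t) *\<^sub>R \<zeta>)))\<^sup>2 / 4) powr (- k)))
     = (\<lambda>\<zeta>. ennreal (t powr - k) * ennreal ((1 + (norm \<zeta>)\<^sup>2) powr (- k)))"
  proof
    fix \<zeta> :: complex
    have "t + (norm (a - (a + (2 * sqrt t) *\<^sub>R \<zeta>)))\<^sup>2 / 4 = t * (1 + (norm \<zeta>)\<^sup>2)"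
      using t by (simp add: power_mult_distrib algebra_simps)
    then show "ennreal ((t + (norm (a - (a + (2 * sqrt t) *\<^sub>R \<zeta>)))\<^sup>2 / 4) powr (- k))
       = ennreal (t powr - k) * ennreal ((1 + (norm \<zeta>)\<^sup>2) powr (- k))"
      by (simp add: powr_mult ennreal_mult)
  qed
  also have "ennreal ((2 * sqrt t)\<^sup>2) * (\<integral>\<^sup>+ \<zeta>. ennreal (t powr - k) * ennreal ((1 + (norm (\<zeta>::complex))\<^sup>2) powr (- k)) \<partial>lborel)
     = ?A * (ennreal t * ennreal (t powr - k))"
    using t by (simp add: nn_integral_cmult ennreal_mult power_mult_distrib ac_simps)
  also have "ennreal t * ennreal (t powr - k) = ennreal (t powr (1 - k))"
    using t by (simp add: ennreal_mult'[symmetric] powr_diff powr_minus field_simps)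
  finally show "(\<integral>\<^sup>+ \<zeta>. ennreal ((t + (norm (a - \<zeta>))\<^sup>2 / 4) powr (- k)) \<partial>lborel)
       = ?A * ennreal (t powr (1 - k))" .
qed

section \<open>The beta-type integral over the half-line\<close>

lemma nn_integral_inverse_Icc:
  fixes a b :: real assumes "0 < a" "a \<le> b"
  shows "(\<integral>\<^sup>+ x. ennreal (1 / x) * indicator {a..b} x \<partial>lborel) = ennreal (ln b - ln a)"
  using assms by (intro nn_integral_FTC_Icc) (auto intro!: derivative_eq_intros)

text \<open>Power functions are monotone in one direction or the other, so their extremes on the
  interval lie at the endpoints. The \<open>min\<close> and \<open>max\<close> spare a case split on
  the sign of the exponent in the comparisons below.\<close>

lemma powr_between_1_2:
  fixes x k :: real assumes "1 \<le> x" "x \<le> 2"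
  shows "min 1 (2 powr k) \<le> x powr k" "x powr k \<le> max 1 (2 powr k)"
proof -
  show "min 1 (2 powr k) \<le> x powr k"
    using assms powr_mono2[of k 1 x] powr_mono2'[of k x 2] by (cases "k \<ge> 0") auto
  show "x powr k \<le> max 1 (2 powr k)"
    using assms powr_mono2[of k x 2] powr_mono2'[of k 1 x] by (cases "k \<ge> 0") auto
qed

text \<open>A logarithmic divergence test: lower bounds of this form arise by comparing an integrand
  with \<open>d / r\<close> on \<open>{1 / N..1}\<close> or on \<open>{1..N}\<close>. A finite value
  \<open>x\<close> is refuted by any \<open>N > exp (x / d)\<close>.\<close>

lemma ennreal_top_if_ln_bounds:
  assumes "\<And>N::nat. N > 0 \<Longrightarrow> ennreal d * ennreal (ln (real N)) \<le> X" and "d > 0"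
  shows "X = top"
proof (rule ccontr)
  assume "X \<noteq> top"
  then obtain x where x: "X = ennreal x" "x \<ge> 0" by (cases X) auto
  obtain N :: nat where N: "real N > exp (x / d)" using reals_Archimedean2 by blast
  then have N0: "N > 0" using exp_gt_zero[of "x / d"] by (metis of_nat_0_less_iff order_less_trans)
  have "ln (real N) > x / d" using N N0 by (metis exp_less_cancel_iff exp_ln of_nat_0_less_iff)
  then have "d * ln (real N) > x" using assms(2) by (simp add: field_simps)
  moreover have "ennreal (d * ln (real N)) \<le> ennreal x"
    using assms(1)[OF N0] assms(2) x N0 by (simp add: ennreal_mult)
  ultimately show False using x(2) by (simp add: ennreal_le_iff)
qed

text \<open>On \<open>r \<le> 1\<close> the factor \<open>1 + r\<close> lies between 1 and 2,
  leaving \<open>r powr b\<close>. On \<open>r \<ge> 1\<close> the same holds for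
  \<open>(1 + r) / r\<close>, leaving \<open>r powr (b - k)\<close>. The two hypotheses are exactly
  the convergence conditions at 0 and at infinity.\<close>

lemma nn_integral_beta_finite:
  fixes b k :: real assumes "b > -1" "k > b + 1"
  shows "(\<integral>\<^sup>+ r\<in>{0<..}. ennreal (r powr b * (1 + r) powr (- k)) \<partial>lborel) < top"
proof -
  let ?d = "max 1 (2 powr (- k))"
  have i1: "(\<integral>\<^sup>+ r. ennreal (indicator {0..1} r * r powr b) \<partial>lborel) = ennreal (1 powr (b + 1) / (b + 1))"
  proof (rule nn_integral_has_integral_lborel)
    have "((\<lambda>x. x powr b) has_integral (1 powr (b + 1) / (b + 1))) {0..1}"
      using assms by (intro has_integral_powr_from_0) auto
    then show "((\<lambda>r. indicator {0..1} r * r powr b) has_integral (1 powr (b + 1) / (b + 1))) UNIV"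
      by (subst (asm) has_integral_restrict_UNIV [symmetric])
         (auto elim!: has_integral_eq[rotated] simp: indicator_def)
  qed (auto simp: indicator_def)
  have i2: "(\<integral>\<^sup>+ r. ennreal (indicator {1..} r * r powr (b - k)) \<partial>lborel) = ennreal (- (1 powr (b - k + 1)) / (b - k + 1))"
  proof (rule nn_integral_has_integral_lborel)
    have "((\<lambda>x. x powr (b - k)) has_integral (- (1 powr (b - k + 1)) / (b - k + 1))) {1..}"
      using assms by (intro has_integral_powr_to_inf) auto
    then show "((\<lambda>r. indicator {1..} r * r powr (b - k)) has_integral (- (1 powr (b - k + 1)) / (b - k + 1))) UNIV"
      by (subst (asm) has_integral_restrict_UNIV [symmetric])
         (auto elim!: has_integral_eq[rotated] simp: indicator_def)
  qed (auto simp: indicator_def)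
  have "ennreal (r powr b * (1 + r) powr (- k)) * indicator {0<..} r \<le>
     ennreal ?d * ennreal (indicator {0..1} r * r powr b) + ennreal ?d * ennreal (indicator {1..} r * r powr (b - k))" for r :: real
  proof (cases "r > 0")
    case True
    show ?thesis
    proof (cases "r \<le> 1")
      case r1: True
      have "r powr b * (1 + r) powr (- k) \<le> r powr b * ?d"
        using powr_between_1_2(2)[of "1 + r" "- k"] True r1 by (intro mult_left_mono) auto
      then have "ennreal (r powr b * (1 + r) powr (- k)) \<le> ennreal ?d * ennreal (r powr b)"
        by (simp add: ennreal_mult'[symmetric] mult.commute ennreal_leI)
      then show ?thesis using True r1 by (auto simp: indicator_def intro: add_increasing2)
    next
      case r1: False
      have "(1 + r) powr (- k) = r powr (- k) * ((1 + r) / r) powr (- k)"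
        using True by (simp add: powr_mult[symmetric])
      also have "\<dots> \<le> r powr (- k) * ?d"
        using powr_between_1_2(2)[of "(1 + r) / r" "- k"] True r1 by (intro mult_left_mono) (auto simp: field_simps)
      finally have "r powr b * (1 + r) powr (- k) \<le> r powr b * (r powr (- k) * ?d)"
        by (intro mult_left_mono) auto
      also have "\<dots> = ?d * r powr (b - k)"
        by (simp add: powr_diff powr_minus field_simps)
      finally have "ennreal (r powr b * (1 + r) powr (- k)) \<le> ennreal ?d * ennreal (r powr (b - k))"
        by (simp add: ennreal_mult'[symmetric] ennreal_leI)
      then show ?thesis using True r1 by (auto simp: indicator_def intro: add_increasing)
    qed
  qed auto
  then have "(\<integral>\<^sup>+ r\<in>{0<..}. ennreal (r powr b * (1 + r) powr (- k)) \<partial>lborel) \<le> (\<integral>\<^sup>+ r. 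
     ennreal ?d * ennreal (indicator {0..1} r * r powr b) + ennreal ?d * ennreal (indicator {1..} r * r powr (b - k)) \<partial>lborel)"
    by (intro nn_integral_mono)
  also have "\<dots> = ennreal ?d * ennreal (1 powr (b + 1) / (b + 1)) + ennreal ?d * ennreal (- (1 powr (b - k + 1)) / (b - k + 1))"
    unfolding i1[symmetric] i2[symmetric] by (subst nn_integral_add) (auto simp: nn_integral_cmult)
  also have "\<dots> < top" by (simp add: ennreal_add_less_top ennreal_mult_less_top)
  finally show ?thesis .
qed

text \<open>If a condition fails, the integrand dominates \<open>d / r\<close> near the
  corresponding end: \<open>r powr b \<ge> 1 / r\<close> on \<open>{1 / N..1}\<close> when
  \<open>b \<le> -1\<close>, and \<open>r powr (b - k) \<ge> 1 / r\<close> on \<open>{1..N}\<close>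
  when \<open>k \<le> b + 1\<close>. The integral then exceeds every
  \<open>d * ln N\<close>.\<close>

lemma nn_integral_beta_finiteD:
  fixes b k :: real
  assumes fin: "(\<integral>\<^sup>+ r\<in>{0<..}. ennreal (r powr b * (1 + r) powr (- k)) \<partial>lborel) < top" (is "?X < _")
  shows "b > -1" "k > b + 1"
proof -
  define d where "d = min 1 (2 powr (- k) :: real)"
  have d: "d > 0" by (simp add: d_def)
  have low: "ennreal d * ennreal (ln y - ln x) \<le> ?X"
    if "0 < x" "x \<le> y" and *: "\<And>r. x \<le> r \<Longrightarrow> r \<le> y \<Longrightarrow> d * (1 / r) \<le> r powr b * (1 + r) powr (- k)" for x y
  proof -
    have "ennreal d * ennreal (ln y - ln x) = (\<integral>\<^sup>+ r. ennreal d * (ennreal (1 / r) * indicator {x..y} r) \<partial>lborel)"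
      using that by (simp add: nn_integral_cmult nn_integral_inverse_Icc)
    also have "\<dots> \<le> ?X"
    proof (intro nn_integral_mono)
      fix r :: real
      show "ennreal d * (ennreal (1 / r) * indicator {x..y} r) \<le> ennreal (r powr b * (1 + r) powr (- k)) * indicator {0<..} r"
        using *[of r] \<open>0 < x\<close> d by (auto simp: indicator_def ennreal_mult'[symmetric] intro!: ennreal_leI)
    qed
    finally show ?thesis .
  qed
  show "b > -1"
  proof (rule ccontr)
    assume "\<not> b > -1"
    have "ennreal d * ennreal (ln (real N)) \<le> ?X" if "N > 0" for N
    proof -
      have "ennreal d * ennreal (ln 1 - ln (1 / real N)) \<le> ?X"
      proof (rule low)
        fix r assume r: "1 / real N \<le> r" "r \<le> 1"
        have r0: "r > 0" using r(1) that by (smt (verit) divide_pos_pos of_nat_0_less_iff)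
        have "1 / r = r powr (-1)" using r0 by (simp add: powr_minus field_simps)
        also have "\<dots> \<le> r powr b" using r0 r \<open>\<not> b > -1\<close> by (intro powr_mono') auto
        finally have "1 / r \<le> r powr b" .
        moreover have "d \<le> (1 + r) powr (- k)" unfolding d_def using r0 r by (intro powr_between_1_2) auto
        ultimately show "d * (1 / r) \<le> r powr b * (1 + r) powr (- k)"
          using d r0 by (subst mult.commute, intro mult_mono) auto
      qed (use that in auto)
      then show ?thesis using that by (simp add: ln_div)
    qed
    then show False using ennreal_top_if_ln_bounds[of d ?X] d fin by auto
  qed
  show "k > b + 1"
  proof (rule ccontr)
    assume nk: "\<not> k > b + 1"
    have "ennreal d * ennreal (ln (real N)) \<le> ?X" if "N > 0" for N
    proof -
      have "ennreal d * ennreal (ln (real N) - ln 1) \<le> ?X"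
      proof (rule low)
        fix r assume r: "1 \<le> r" "r \<le> real N"
        have "1 / r = r powr (-1)" using r by (simp add: powr_minus field_simps)
        also have "\<dots> \<le> r powr (b - k)" using r nk by (intro powr_mono) auto
        finally have 1: "1 / r \<le> r powr (b - k)" .
        have 2: "d \<le> ((1 + r) / r) powr (- k)" unfolding d_def using r by (intro powr_between_1_2) (auto simp: field_simps)
        have "d * (1 / r) \<le> ((1 + r) / r) powr (- k) * r powr (b - k)"
          using 1 2 d r by (intro mult_mono) auto
        also have "\<dots> = r powr b * (r powr (- k) * ((1 + r) / r) powr (- k))"
          by (simp add: powr_diff powr_minus field_simps)
        also have "\<dots> = r powr b * (1 + r) powr (- k)"
          using r by (simp add: powr_mult[symmetric])
        finally show "d * (1 / r) \<le> r powr b * (1 + r) powr (- k)" .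
      qed (use that in auto)
      then show ?thesis by simp
    qed
    then show False using ennreal_top_if_ln_bounds[of d ?X] d fin by auto
  qed
qed

text \<open>Substituting \<open>t * r\<close> for \<open>r\<close> scales \<open>t\<close> out. The
  equivalence for \<open>H < top\<close> is the source of both conditions on the exponents in the
  first variable.\<close>

lemma nn_integral_half_line_powr:
  fixes b k :: real
  obtains H :: ennreal where "H > 0" "H < top \<longleftrightarrow> b > -1 \<and> k > b + 1"
    "\<And>t. t > 0 \<Longrightarrow> (\<integral>\<^sup>+ r\<in>{0<..}. ennreal (r powr b * (t + r) powr (- k)) \<partial>lborel) = H * ennreal (t powr (b + 1 - k))"
proof
  let ?H = "\<integral>\<^sup>+ r\<in>{0<..}. ennreal (r powr b * (1 + r) powr (- k)) \<partial>lborel"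
  show "?H > 0"
    by (rule nn_integral_pos[where A = "{1..2}"]) auto
  show "?H < top \<longleftrightarrow> b > -1 \<and> k > b + 1"
    using nn_integral_beta_finite[of b k] nn_integral_beta_finiteD[of b k] by blast
  fix t :: real assume t: "t > 0"
  have "(\<integral>\<^sup>+ r\<in>{0<..}. ennreal (r powr b * (t + r) powr (- k)) \<partial>lborel)
    = ennreal t * (\<integral>\<^sup>+ r. ennreal ((t * r) powr b * (t + t * r) powr (- k)) * indicator {0<..} (t * r) \<partial>lborel)"
    using t by (subst nn_integral_real_affine[of _ t 0]) auto
  also have "(\<lambda>r. ennreal ((t * r) powr b * (t + t * r) powr (- k)) * indicator {0<..} (t * r))
     = (\<lambda>r. ennreal (t powr (b - k)) * (ennreal (r powr b * (1 + r) powr (- k)) * indicator {0<..} r))"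
  proof
    fix r
    show "ennreal ((t * r) powr b * (t + t * r) powr (- k)) * indicator {0<..} (t * r)
      = ennreal (t powr (b - k)) * (ennreal (r powr b * (1 + r) powr (- k)) * indicator {0<..} r)"
    proof (cases "r > 0")
      case True
      have "(t + t * r) powr (- k) = t powr (- k) * (1 + r) powr (- k)"
        by (simp add: powr_mult[symmetric] algebra_simps)
      then show ?thesis using t True
        by (simp add: powr_mult ennreal_mult'[symmetric] powr_diff powr_minus field_simps zero_less_mult_iff)
    qed (use t in \<open>simp add: zero_less_mult_iff\<close>)
  qed
  also have "ennreal t * (\<integral>\<^sup>+ r. ennreal (t powr (b - k)) * (ennreal (r powr b * (1 + r) powr (- k)) * indicator {0<..} r) \<partial>lborel)
     = ?H * (ennreal t * ennreal (t powr (b - k)))"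
    by (subst nn_integral_cmult) (auto simp: ac_simps)
  also have "ennreal t * ennreal (t powr (b - k)) = ennreal (t powr (b + 1 - k))"
    using t by (simp add: ennreal_mult'[symmetric] powr_diff powr_add field_simps)
  finally show "(\<integral>\<^sup>+ r\<in>{0<..}. ennreal (r powr b * (t + r) powr (- k)) \<partial>lborel) = ?H * ennreal (t powr (b + 1 - k))" .
qed

text \<open>Integrating out one complex coordinate lowers the exponent \<open>k\<close> by one,
  hence the induction on \<open>m\<close> with \<open>k\<close> arbitrary.\<close>

lemma nn_integral_PiM_powr:
  fixes k :: real
  shows "\<exists>A::ennreal. A > 0 \<and> (k > real m \<longrightarrow> A < top) \<and> (\<forall>t>0. \<forall>z.
    (\<integral>\<^sup>+ u. ennreal ((t + (\<Sum>j<m. (norm (z j - u j))\<^sup>2 / 4)) powr (- k)) \<partial>PiM {..<m} (\<lambda>_. lborel :: complex measure))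
       = A * ennreal (t powr (real m - k)))"
proof (induction m arbitrary: k)
  case 0
  show ?case by (intro exI[of _ 1]) (simp add: space_PiM)
next
  case (Suc m)
  interpret product_sigma_finite "\<lambda>_. lborel :: complex measure" ..
  obtain A1 where A1: "A1 > 0" "k > 1 \<Longrightarrow> A1 < top"
    "\<And>t (a :: complex). t > 0 \<Longrightarrow> (\<integral>\<^sup>+ \<zeta>. ennreal ((t + (norm (a - \<zeta>))\<^sup>2 / 4) powr (- k)) \<partial>lborel)
       = A1 * ennreal (t powr (1 - k))"
    using nn_integral_complex_plane_powr[of k] by blast
  obtain A2 where A2: "A2 > 0" "k - 1 > real m \<Longrightarrow> A2 < top"
    "\<And>t z. t > 0 \<Longrightarrow> (\<integral>\<^sup>+ u. ennreal ((t + (\<Sum>j<m. (norm (z j - u j))\<^sup>2 / 4)) powr (- (k - 1))) \<partial>PiM {..<m} (\<lambda>_. lborel :: complex measure))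
       = A2 * ennreal (t powr (real m - (k - 1)))"
    using Suc.IH[of "k - 1"] by (elim exE conjE) (rule that; blast)
  have main: "(\<integral>\<^sup>+ u. ennreal ((t + (\<Sum>j<Suc m. (norm (z j - u j))\<^sup>2 / 4)) powr (- k)) \<partial>PiM {..<Suc m} (\<lambda>_. lborel :: complex measure))
       = (A1 * A2) * ennreal (t powr (real (Suc m) - k))" if t: "t > 0" for t z
  proof -
    have [measurable]: "(\<lambda>u. u j) \<in> borel_measurable (PiM {..<Suc m} (\<lambda>_. lborel :: complex measure))" if "j < Suc m" for j
      using measurable_component_singleton[of j "{..<Suc m}" "\<lambda>_. lborel :: complex measure"] that by simp
    have [measurable]: "(\<lambda>u. u j) \<in> borel_measurable (PiM {..<m} (\<lambda>_. lborel :: complex measure))" if "j < m" for j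
      using measurable_component_singleton[of j "{..<m}" "\<lambda>_. lborel :: complex measure"] that by simp
    have upd: "(\<Sum>j<Suc m. (norm (z j - (u(m := \<zeta>)) j))\<^sup>2 / 4)
        = (\<Sum>j<m. (norm (z j - u j))\<^sup>2 / 4) + (norm (z m - \<zeta>))\<^sup>2 / 4" for u \<zeta>
      by (auto intro!: sum.cong)
    have "(\<integral>\<^sup>+ u. ennreal ((t + (\<Sum>j<Suc m. (norm (z j - u j))\<^sup>2 / 4)) powr (- k)) \<partial>PiM {..<Suc m} (\<lambda>_. lborel :: complex measure))
      = (\<integral>\<^sup>+ u. \<integral>\<^sup>+ \<zeta>. ennreal ((t + (\<Sum>j<Suc m. (norm (z j - (u(m := \<zeta>)) j))\<^sup>2 / 4)) powr (- k)) \<partial>lborel \<partial>PiM {..<m} (\<lambda>_. lborel :: complex measure))"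
      unfolding lessThan_Suc[of m] by (rule product_nn_integral_insert) (auto simp: lessThan_Suc[symmetric])
    also have "\<dots> = (\<integral>\<^sup>+ u. A1 * ennreal ((t + (\<Sum>j<m. (norm (z j - u j))\<^sup>2 / 4)) powr (- (k - 1))) \<partial>PiM {..<m} (\<lambda>_. lborel :: complex measure))"
      \<comment> \<open>The inner integral is the plane integral with \<open>t\<close> enlarged by
        the nonnegative sum over the remaining coordinates.\<close>
      unfolding upd add.assoc[symmetric]
      by (intro nn_integral_cong, subst A1(3)) (auto intro!: add_pos_nonneg sum_nonneg t)
    also have "\<dots> = A1 * (A2 * ennreal (t powr (real m - (k - 1))))"
      by (subst nn_integral_cmult) (auto simp: A2(3)[OF t, of z, simplified])
    also have "real m - (k - 1) = real (Suc m) - k" by simp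
    finally show ?thesis by (simp only: mult.assoc)
  qed
  then show ?case using A1 A2
    by (intro exI[of _ "A1 * A2"]) (auto simp: ennreal_zero_less_mult_iff ennreal_mult_less_top)
qed

section \<open>The integral of the kernel over the tube\<close>

interpretation lebC: product_sigma_finite "\<lambda>_::nat. lborel :: complex measure" ..

lemma measurable_lebC_component:
  assumes "f \<in> measurable M (lebC n)" "j < n"
  shows "(\<lambda>x. f x j) \<in> borel_measurable M"
  using measurable_compose[OF assms(1)[unfolded lebC_def] measurable_component_singleton[of j "{..<n}" "\<lambda>_. lborel :: complex measure"]] assms(2)
  by simp

lemma measurable_rho [measurable (raw)]:
  assumes "f \<in> measurable M (lebC n)" "n \<ge> 1"
  shows "(\<lambda>x. rho n (f x)) \<in> borel_measurable M"
proof -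
  have [measurable]: "(\<lambda>x. f x j) \<in> borel_measurable M" if "j < n" for j
    using measurable_lebC_component[OF assms(1) that] .
  show ?thesis unfolding rho_def
    using assms(2) by (intro borel_measurable_diff borel_measurable_sum borel_measurable_power) auto
qed

lemma measurable_rho2 [measurable (raw)]:
  assumes "f \<in> measurable M (lebC n)" "g \<in> measurable M (lebC n)" "n \<ge> 1"
  shows "(\<lambda>x. rho2 n (f x) (g x)) \<in> borel_measurable M"
proof -
  have 1: "(\<lambda>x. f x j) \<in> borel_measurable M" "(\<lambda>x. cnj (g x j)) \<in> borel_measurable M" if "j < n" for j
    using measurable_lebC_component[OF assms(1) that] measurable_lebC_component[OF assms(2) that]
    by (auto intro: borel_measurable_continuous_on[where f = cnj] continuous_intros)
  show ?thesis unfolding rho2_def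
    using assms(3) by (intro borel_measurable_diff borel_measurable_sum borel_measurable_times borel_measurable_power 1) auto
qed

lemma tube_eq: "tube n = {z \<in> space (lebC n). rho n z > 0}"
  by (auto simp: tube_def rho_def)

lemma rho_pos: "z \<in> tube n \<Longrightarrow> rho n z > 0"
  by (simp add: tube_eq)

lemma sets_tube [measurable]: "n \<ge> 1 \<Longrightarrow> tube n \<in> sets (lebC n)"
  unfolding tube_eq by measurable

text \<open>The terms \<open>- 2 * (Im (z j))^2\<close> and \<open>- 2 * (Im (u j))^2\<close> from
  the real part of the square combine with the imaginary parts of the last coordinates into
  \<open>rho n z + rho n u\<close>. For fixed \<open>z\<close>, the variable
  \<open>Re (u (n-1))\<close> occurs only in the imaginary part, affinely with slope 1/2, so it can
  be integrated first.\<close>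

lemma rho2_eq:
  "rho2 n z u = Complex ((\<Sum>j<n-1. (norm (z j - u j))\<^sup>2 / 4) + (rho n z + rho n u) / 2)
     ((Re (u (n-1)) - (Re (z (n-1)) - (\<Sum>j<n-1. (Re (z j) - Re (u j)) * (Im (z j) + Im (u j))))) / 2)"
proof (rule complex_eqI)
  have *: "Re ((z j - cnj (u j))\<^sup>2) = (norm (z j - u j))\<^sup>2 - 2 * (Im (z j))\<^sup>2 - 2 * (Im (u j))\<^sup>2" for j
    by (simp add: cmod_power2) (simp add: power2_eq_square algebra_simps)
  show "Re (rho2 n z u) = Re (Complex ((\<Sum>j<n-1. (norm (z j - u j))\<^sup>2 / 4) + (rho n z + rho n u) / 2)
     ((Re (u (n-1)) - (Re (z (n-1)) - (\<Sum>j<n-1. (Re (z j) - Re (u j)) * (Im (z j) + Im (u j))))) / 2))"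
    unfolding rho2_def by (simp add: * rho_def sum_subtractf sum_distrib_left[symmetric] sum_divide_distrib[symmetric] sum.distrib field_simps)
  have "Im ((z j - cnj (u j))\<^sup>2) = 2 * ((Re (z j) - Re (u j)) * (Im (z j) + Im (u j)))" for j
    by (simp add: power2_eq_square algebra_simps)
  then show "Im (rho2 n z u) = Im (Complex ((\<Sum>j<n-1. (norm (z j - u j))\<^sup>2 / 4) + (rho n z + rho n u) / 2)
     ((Re (u (n-1)) - (Re (z (n-1)) - (\<Sum>j<n-1. (Re (z j) - Re (u j)) * (Im (z j) + Im (u j))))) / 2))"
    unfolding rho2_def by (simp add: sum_distrib_left[symmetric])
qed

lemma Re_rho2_ge: "Re (rho2 n z u) \<ge> (rho n z + rho n u) / 2"
  by (simp add: rho2_eq sum_nonneg)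

lemma norm_rho2_ge: "norm (rho2 n z u) \<ge> (rho n z + rho n u) / 2"
  using Re_rho2_ge complex_Re_le_cmod order_trans by blast

section \<open>The weighted measures on the tube\<close>

lemma sets_dVa [measurable_cong, simp]: "sets (dVa n \<alpha>) = sets (lebC n)"
  by (simp add: dVa_def)

lemma space_dVa [simp]: "space (dVa n \<alpha>) = space (lebC n)"
  by (simp add: dVa_def)

lemma sigma_finite_lebC: "sigma_finite_measure (lebC n)"
  unfolding lebC_def by (rule lebC.sigma_finite) simp

lemma sigma_finite_dVa: "n \<ge> 1 \<Longrightarrow> sigma_finite_measure (dVa n \<alpha>)"
proof -
  assume n: "n \<ge> 1"
  interpret sigma_finite_measure "lebC n" by (rule sigma_finite_lebC)
  show ?thesis unfolding dVa_def using n
    by (subst sigma_finite_iff_density_finite) (auto simp: ennreal_mult_eq_top_iff indicator_def)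
qed

text \<open>The density is positive exactly on the tube, so the null sets are the same for all
  weights. This lets almost-everywhere statements pass between different values of
  \<open>\<alpha>\<close>.\<close>

lemma AE_dVa_iff:
  assumes "n \<ge> 1"
  shows "(AE z in dVa n \<alpha>. P z) \<longleftrightarrow> (AE z in lebC n. z \<in> tube n \<longrightarrow> P z)"
proof -
  have "0 < indicator (tube n) z * ennreal (rho n z powr \<alpha>) \<longleftrightarrow> z \<in> tube n" for z
    using rho_pos[of z n] by (auto simp: indicator_def)
  then show ?thesis unfolding dVa_def using assms by (subst AE_density) auto
qed

lemma nn_integral_dVa:
  assumes "n \<ge> 1" and [measurable]: "f \<in> borel_measurable (lebC n)"
  shows "(\<integral>\<^sup>+ z. f z \<partial>dVa n \<alpha>) = (\<integral>\<^sup>+ z\<in>tube n. ennreal (rho n z powr \<alpha>) * f z \<partial>lebC n)"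
  unfolding dVa_def using assms(1)
  by (subst nn_integral_density) (auto intro!: nn_integral_cong simp: ac_simps)

lemma nn_integral_dVa_0:
  assumes "n \<ge> 1" and [measurable]: "f \<in> borel_measurable (lebC n)"
  shows "(\<integral>\<^sup>+ z. f z \<partial>dVa n 0) = (\<integral>\<^sup>+ z\<in>tube n. f z \<partial>lebC n)"
  using assms(1) by (subst nn_integral_dVa) (auto intro!: nn_integral_cong simp: indicator_def tube_eq)

lemma nn_integral_dVa_shift:
  assumes "n \<ge> 1" and [measurable]: "f \<in> borel_measurable (lebC n)"
  shows "(\<integral>\<^sup>+ z. f z \<partial>dVa n \<alpha>) = (\<integral>\<^sup>+ z. ennreal (rho n z powr \<alpha>) * f z \<partial>dVa n 0)"
  using assms(1) by (subst nn_integral_dVa_0) (auto simp: nn_integral_dVa)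

text \<open>The constant is the product of those of the line, the product-space and the half-line
  integrals, and only the half-line one decides its finiteness.\<close>

lemma nn_integral_rho2_powr:
  fixes b c :: real
  assumes n: "n \<ge> 1"
  obtains H :: ennreal where "H > 0" "H < top \<longleftrightarrow> b > -1 \<and> c > real n + 1 + b"
    "\<And>z. z \<in> tube n \<Longrightarrow> (\<integral>\<^sup>+ u. ennreal (rho n u powr b * norm (rho2 n z u) powr (- c)) \<partial>dVa n 0)
       = H * ennreal (rho n z powr (real n + 1 + b - c))"
proof -
  obtain m where m: "n = Suc m" using n by (cases n) auto
  obtain B where B: "B > 0" "c > 1 \<Longrightarrow> B < top"
    "\<And>t a. t > 0 \<Longrightarrow> (\<integral>\<^sup>+ s. ennreal (norm (Complex t ((s - a) / 2)) powr (- c)) \<partial>lborel)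
       = B * ennreal (t powr (1 - c))"
    using nn_integral_norm_Complex_powr[of c] by blast
  obtain A where A: "A > 0" "c - 1 > real m \<Longrightarrow> A < top"
    "\<And>t z. t > 0 \<Longrightarrow> (\<integral>\<^sup>+ u. ennreal ((t + (\<Sum>j<m. (norm (z j - u j))\<^sup>2 / 4)) powr (- (c - 1))) \<partial>PiM {..<m} (\<lambda>_. lborel :: complex measure))
       = A * ennreal (t powr (real m - (c - 1)))"
    using nn_integral_PiM_powr[where k = "c - 1" and m = m] by (elim exE conjE) (rule that; blast)
  obtain H where H: "H > 0" "H < top \<longleftrightarrow> b > -1 \<and> c - real n > b + 1"
    "\<And>t. t > 0 \<Longrightarrow> (\<integral>\<^sup>+ r\<in>{0<..}. ennreal (r powr b * (t + r) powr (- (c - real n))) \<partial>lborel) = H * ennreal (t powr (b + 1 - (c - real n)))"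
    using nn_integral_half_line_powr[of b "c - real n"] by blast
  \<comment> \<open>The power of 2 comes from the halved sum \<open>(t + r) / 2\<close> in the real
    part of \<open>rho2\<close>.\<close>
  define K where "K = B * A * ennreal (2 powr (c - real n)) * H"
  have "K > 0" using A(1) B(1) H(1) by (simp add: K_def ennreal_zero_less_mult_iff)
  moreover have "K < top \<longleftrightarrow> b > -1 \<and> c > real n + 1 + b"
  proof
    \<comment> \<open>Positivity of the other factors prevents them from hiding an infinite
      \<open>H\<close>.\<close>
    assume "K < top"
    then have "H < top"
      using A(1) B(1) H(1) by (auto simp: K_def ennreal_mult_less_top ennreal_zero_less_mult_iff)
    then show "b > -1 \<and> c > real n + 1 + b" using H(2) by auto
  next
    assume *: "b > -1 \<and> c > real n + 1 + b"
    \<comment> \<open>From \<open>b > -1\<close> one gets \<open>c > real n = real m + 1\<close>,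
      which is more than the first two integrals require.\<close>
    then have "c > 1" "c - 1 > real m" "b > -1 \<and> c - real n > b + 1" using m by auto
    then have "A < top" "B < top" "H < top" using A(2) B(2) H(2) by auto
    then show "K < top" by (simp add: K_def ennreal_mult_less_top)
  qed
  moreover have "(\<integral>\<^sup>+ u. ennreal (rho n u powr b * norm (rho2 n z u) powr (- c)) \<partial>dVa n 0)
       = K * ennreal (rho n z powr (real n + 1 + b - c))" if z: "z \<in> tube n" for z
  proof -
    define t where "t = rho n z"
    have t: "t > 0" using z by (simp add: t_def rho_pos)
    have zs: "z \<in> space (lebC n)" using z by (simp add: tube_eq)
    \<comment> \<open>Writing the tube as an indicator in \<open>rho n u\<close> allows integration
      over the whole space; after the shift below it becomes the half-line
      \<open>r > 0\<close>.\<close>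
    define F where "F u = ennreal (rho n u powr b * norm (rho2 n z u) powr (- c)) * indicator {0<..} (rho n u)" for u
    have Fm[measurable]: "F \<in> borel_measurable (lebC n)"
      unfolding F_def using n zs by measurable
    let ?P = "PiM {..<m} (\<lambda>_. lborel :: complex measure)"
    define q where "q u = (\<Sum>j<m. (Im (u j))\<^sup>2)" for u :: "nat \<Rightarrow> complex"
    define S where "S u = (\<Sum>j<m. (norm (z j - u j))\<^sup>2 / 4)" for u :: "nat \<Rightarrow> complex"
    define a where "a u = Re (z m) - (\<Sum>j<m. (Re (z j) - Re (u j)) * (Im (z j) + Im (u j)))" for u :: "nat \<Rightarrow> complex"
    have cm[measurable]: "(\<lambda>u. u j) \<in> borel_measurable ?P" if "j < m" for j
      using measurable_component_singleton[of j "{..<m}" "\<lambda>_. lborel :: complex measure"] that by simp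
    have [measurable]: "S \<in> borel_measurable ?P"
      unfolding S_def by measurable
    have S0: "S u \<ge> 0" for u unfolding S_def by (intro sum_nonneg) auto
    have F_upd: "F (u(m := Complex s v)) = ennreal ((v - q u) powr b) * indicator {0<..} (v - q u) *
        ennreal (norm (Complex (S u + (t + (v - q u)) / 2) ((s - a u) / 2)) powr (- c))" for u s v
    proof -
      have *: "rho n (u(m := Complex s v)) = v - q u"
        by (simp add: rho_def m q_def)
      have "rho2 n z (u(m := Complex s v)) = Complex (S u + (t + (v - q u)) / 2) ((s - a u) / 2)"
        unfolding rho2_eq * by (simp add: m S_def t_def a_def)
      then show ?thesis unfolding F_def * by (simp add: ennreal_mult ac_simps)
    qed
    have "(\<integral>\<^sup>+ u. ennreal (rho n u powr b * norm (rho2 n z u) powr (- c)) \<partial>dVa n 0) = (\<integral>\<^sup>+ u. F u \<partial>lebC n)"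
      using n zs by (subst nn_integral_dVa_0) (auto intro!: nn_integral_cong simp: F_def tube_eq indicator_def)
    also have "\<dots> = (\<integral>\<^sup>+ u. \<integral>\<^sup>+ \<zeta>. F (u(m := \<zeta>)) \<partial>lborel \<partial>?P)"
      unfolding lebC_def m lessThan_Suc
      by (rule lebC.product_nn_integral_insert) (use Fm in \<open>simp_all add: lebC_def m lessThan_Suc\<close>)
    also have "\<dots> = (\<integral>\<^sup>+ u. \<integral>\<^sup>+ v. \<integral>\<^sup>+ s. F (u(m := Complex s v)) \<partial>lborel \<partial>lborel \<partial>?P)"
    proof (intro nn_integral_cong nn_integral_lborel_complex)
      fix u assume "u \<in> space ?P"
      then have "(\<lambda>\<zeta>. u(m := \<zeta>)) \<in> measurable lborel (lebC n)"
        unfolding lebC_def m lessThan_Suc by (intro measurable_fun_upd[where J = "{..<m}"]) auto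
      from measurable_compose[OF this Fm] show "(\<lambda>\<zeta>. F (u(m := \<zeta>))) \<in> borel_measurable borel" by simp
    qed
    also have "\<dots> = (\<integral>\<^sup>+ u. \<integral>\<^sup>+ v. ennreal ((v - q u) powr b) * indicator {0<..} (v - q u) *
         (B * ennreal ((S u + (t + (v - q u)) / 2) powr (1 - c))) \<partial>lborel \<partial>?P)"
    proof (intro nn_integral_cong)
      fix u v
      show "(\<integral>\<^sup>+ s. F (u(m := Complex s v)) \<partial>lborel) = ennreal ((v - q u) powr b) * indicator {0<..} (v - q u) *
         (B * ennreal ((S u + (t + (v - q u)) / 2) powr (1 - c)))"
      proof (cases "v - q u > 0")
        case True
        then have "S u + (t + (v - q u)) / 2 > 0" using S0[of u] t by (intro add_nonneg_pos) auto
        moreover have "(\<lambda>s. ennreal (norm (Complex (S u + (t + (v - q u)) / 2) ((s - a u) / 2)) powr (- c))) \<in> borel_measurable lborel"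
          unfolding norm_Complex_powr by measurable
        ultimately show ?thesis unfolding F_upd by (simp add: nn_integral_cmult B(3))
      qed (simp add: F_upd)
    qed
    \<comment> \<open>For fixed \<open>u'\<close> the variable \<open>r = v - q u\<close> is a
      translate of \<open>v\<close>; it equals \<open>rho\<close> of the full point.\<close>
    also have "\<dots> = (\<integral>\<^sup>+ u. \<integral>\<^sup>+ r. ennreal (r powr b) * indicator {0<..} r *
         (B * ennreal ((S u + (t + r) / 2) powr (1 - c))) \<partial>lborel \<partial>?P)"
    proof (rule nn_integral_cong)
      fix u
      show "(\<integral>\<^sup>+ v. ennreal ((v - q u) powr b) * indicator {0<..} (v - q u) *
           (B * ennreal ((S u + (t + (v - q u)) / 2) powr (1 - c))) \<partial>lborel)
         = (\<integral>\<^sup>+ r. ennreal (r powr b) * indicator {0<..} r * (B * ennreal ((S u + (t + r) / 2) powr (1 - c))) \<partial>lborel)"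
        by (subst nn_integral_real_affine[where c = 1 and t = "q u"]) auto
    qed
    \<comment> \<open>Exchanging the order puts the integral over \<open>u'\<close> inside, where
      \<open>(t + r) / 2\<close> plays the part of the constant \<open>t\<close> in the
      product-space lemma.\<close>
    also have "\<dots> = (\<integral>\<^sup>+ r. \<integral>\<^sup>+ u. ennreal (r powr b) * indicator {0<..} r *
         (B * ennreal ((S u + (t + r) / 2) powr (1 - c))) \<partial>?P \<partial>lborel)"
    proof -
      interpret pair_sigma_finite ?P "lborel :: real measure"
        unfolding pair_sigma_finite_def by (auto intro: lebC.sigma_finite lborel.sigma_finite_measure_axioms)
      show ?thesis by (rule Fubini'[symmetric]) measurable
    qed
    also have "\<dots> = (\<integral>\<^sup>+ r. B * A * ennreal (2 powr (c - real n)) *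
         (ennreal (r powr b * (t + r) powr (- (c - real n))) * indicator {0<..} r) \<partial>lborel)"
    proof (intro nn_integral_cong)
      fix r :: real
      show "(\<integral>\<^sup>+ u. ennreal (r powr b) * indicator {0<..} r * (B * ennreal ((S u + (t + r) / 2) powr (1 - c))) \<partial>?P)
        = B * A * ennreal (2 powr (c - real n)) * (ennreal (r powr b * (t + r) powr (- (c - real n))) * indicator {0<..} r)"
      proof (cases "r > 0")
        case True
        then have tr: "(t + r) / 2 > 0" using t by simp
        have e: "(S u + (t + r) / 2) powr (1 - c) = ((t + r) / 2 + S u) powr (- (c - 1))" for u
          by (simp add: add.commute)
        have "(\<integral>\<^sup>+ u. ennreal ((S u + (t + r) / 2) powr (1 - c)) \<partial>?P) = A * ennreal (((t + r) / 2) powr (real m - (c - 1)))"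
          unfolding e unfolding S_def by (rule A(3)[OF tr])
        also have "real m - (c - 1) = - (c - real n)" using m by simp
        also have "((t + r) / 2) powr (- (c - real n)) = 2 powr (c - real n) * (t + r) powr (- (c - real n))"
          using tr by (simp add: powr_divide powr_minus powr_diff field_simps)
        finally show ?thesis using True
          by (subst nn_integral_cmult, simp, subst nn_integral_cmult) (auto simp: ennreal_mult ac_simps)
      qed auto
    qed
    also have "\<dots> = B * A * ennreal (2 powr (c - real n)) * (H * ennreal (t powr (b + 1 - (c - real n))))"
      by (subst nn_integral_cmult) (simp, simp only: H(3)[OF t])
    also have "b + 1 - (c - real n) = real n + 1 + b - c" by simp
    finally show ?thesis by (simp add: K_def t_def ac_simps)
  qed
  ultimately show ?thesis using that by blast
qed

section \<open>Reading exponents off bounded powers\<close>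

lemma powr_bounded_near_0:
  fixes p C :: real
  assumes "\<And>t. 0 < t \<Longrightarrow> t \<le> 1 \<Longrightarrow> t powr p \<le> C"
  shows "p \<ge> 0"
proof (rule ccontr)
  assume "\<not> p \<ge> 0"
  then have p: "p < 0" by simp
  \<comment> \<open>This \<open>x\<close> exceeds both \<open>C\<close> and 1. Since
    \<open>p < 0\<close>, the point \<open>x powr (1 / p)\<close> lies in the allowed range, and its
    \<open>p\<close>-th power is \<open>x\<close>.\<close>
  define x where "x = max C 1 + 1"
  have x: "x > 1" by (simp add: x_def)
  have "(x powr (1 / p)) powr p \<le> C"
    using p x powr_mono2'[of "1 / p" 1 x] by (intro assms) (auto simp: field_simps)
  then have "x \<le> C" using p x by (simp add: powr_powr)
  then show False by (simp add: x_def)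
qed

lemma powr_bounded_imp_zero:
  fixes p C :: real
  assumes "\<And>t. 0 < t \<Longrightarrow> t powr p \<le> C"
  shows "p = 0"
proof -
  have "t powr (- p) \<le> C" if "0 < t" for t
    using assms[of "1 / t"] that by (simp add: powr_divide powr_minus_divide)
  then have "- p \<ge> 0" by (intro powr_bounded_near_0[of _ C]) auto
  moreover have "p \<ge> 0" using assms by (intro powr_bounded_near_0[of _ C]) auto
  ultimately show ?thesis by simp
qed

text \<open>The sum of the endpoint values gives one upper bound for exponents of either
  sign.\<close>

lemma powr_le_sum_endpoints:
  fixes x l r p :: real
  assumes "0 < l" "l \<le> x" "x \<le> r"
  shows "x powr p \<le> l powr p + r powr p"
proof (cases "p \<ge> 0")
  case True
  then have "x powr p \<le> r powr p" using assms by (intro powr_mono2) auto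
  then show ?thesis by (simp add: add_increasing)
next
  case False
  then have "x powr p \<le> l powr p" using assms by (intro powr_mono2') auto
  then show ?thesis by (simp add: add_increasing2)
qed

lemma LIMSEQ_if_norm_less:
  fixes l :: "'a :: real_normed_vector"
  assumes "\<And>i. norm (f i - l) < e / real (Suc i)"
  shows "f \<longlonglongrightarrow> l"
proof (rule LIM_zero_cancel, rule Lim_null_comparison)
  show "\<forall>\<^sub>F i in sequentially. norm (f i - l) \<le> e / real (Suc i)"
    using assms by (intro always_eventually allI less_imp_le)
  show "(\<lambda>i. e / real (Suc i)) \<longlonglongrightarrow> 0"
    using tendsto_mult_right_zero[OF LIMSEQ_inverse_real_of_nat, of e] by (simp add: field_simps)
qed

section \<open>Continuity on the tube, full-measure sets and measurability\<close>

lemma tendsto_rho: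
  assumes "n \<ge> 1" "\<And>j. j < n \<Longrightarrow> (\<lambda>i. zs i j) \<longlonglongrightarrow> z j"
  shows "(\<lambda>i. rho n (zs i)) \<longlonglongrightarrow> rho n z"
  unfolding rho_def using assms by (auto intro!: tendsto_intros)

lemma tendsto_rho2:
  assumes "n \<ge> 1" "\<And>j. j < n \<Longrightarrow> (\<lambda>i. zs i j) \<longlonglongrightarrow> z j" "\<And>j. j < n \<Longrightarrow> (\<lambda>i. us i j) \<longlonglongrightarrow> u j"
  shows "(\<lambda>i. rho2 n (zs i) (us i)) \<longlonglongrightarrow> rho2 n z u"
  unfolding rho2_def using assms by (auto intro!: tendsto_intros)

lemma Re_rho2_pos: "z \<in> tube n \<Longrightarrow> u \<in> tube n \<Longrightarrow> Re (rho2 n z u) > 0"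
  using Re_rho2_ge[of n z u] by (auto simp: tube_eq)

lemma rho2_nonzero: "z \<in> tube n \<Longrightarrow> u \<in> tube n \<Longrightarrow> rho2 n z u \<noteq> 0"
  using Re_rho2_pos by fastforce

text \<open>A crude bound is enough: with the lower bound \<open>norm_rho2_ge\<close> it confines
  \<open>norm (rho2 n z u)\<close> to a compact subinterval of the positive reals on bounded sets
  away from the boundary, where all powers are bounded.\<close>

lemma norm_rho2_le:
  assumes "n \<ge> 1" "\<And>j. j < n \<Longrightarrow> norm (z j) \<le> X" "\<And>j. j < n \<Longrightarrow> norm (u j) \<le> X"
  shows "norm (rho2 n z u) \<le> real n * X\<^sup>2 + X"
proof -
  have d: "norm (z j - cnj (u j)) \<le> 2 * X" if "j < n" for j
    using norm_triangle_ineq4[of "z j" "cnj (u j)"] assms(2,3)[OF that] by simp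
  have X: "X \<ge> 0" using assms(2)[of 0] assms(1) norm_ge_zero[of "z 0"] by linarith
  have "norm (\<Sum>j<n-1. (z j - cnj (u j))\<^sup>2) \<le> (\<Sum>j<n-1. (2 * X)\<^sup>2)"
    using d by (intro sum_norm_le) (simp only: norm_power, intro power_mono, auto)
  also have "\<dots> \<le> real n * (4 * X\<^sup>2)"
    by (simp add: power_mult_distrib mult_right_mono)
  finally have 1: "norm (\<Sum>j<n-1. (z j - cnj (u j))\<^sup>2) \<le> 4 * (real n * X\<^sup>2)" by simp
  have 2: "norm (2 * \<i> * (z (n-1) - cnj (u (n-1)))) \<le> 4 * X"
    using d[of "n - 1"] assms(1) by (simp add: norm_mult)
  have "norm (rho2 n z u) = (1/4) * norm ((\<Sum>j<n-1. (z j - cnj (u j))\<^sup>2) - 2 * \<i> * (z (n-1) - cnj (u (n-1))))"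
    unfolding rho2_def by (simp add: norm_mult norm_divide)
  also have "\<dots> \<le> (1/4) * (4 * (real n * X\<^sup>2) + 4 * X)"
    using norm_triangle_ineq4[of "\<Sum>j<n-1. (z j - cnj (u j))\<^sup>2" "2 * \<i> * (z (n-1) - cnj (u (n-1)))"] 1 2
    by (intro mult_left_mono) auto
  finally show ?thesis by simp
qed

text \<open>A small polydisc around \<open>z0\<close> lies inside the tube and has positive measure,
  so it meets every set of full measure. This makes it possible to approach any point through points
  where an almost-everywhere bound holds.\<close>

lemma AE_dVa_near:
  assumes n: "n \<ge> 1" and ae: "AE z in dVa n \<alpha>. P z" and z0: "z0 \<in> tube n" and e: "e > 0"
  obtains z where "z \<in> tube n" "P z" "\<And>j. j < n \<Longrightarrow> norm (z j - z0 j) < e"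
proof -
  \<comment> \<open>Openness of the tube, obtained from coordinatewise sequential continuity of
    \<open>rho\<close>: points of ever smaller polydiscs with \<open>rho n z \<le> 0\<close> would
    force \<open>rho n z0 \<le> 0\<close>.\<close>
  have "\<exists>i::nat. \<forall>z \<in> space (lebC n). (\<forall>j<n. norm (z j - z0 j) < e / real (Suc i)) \<longrightarrow> rho n z > 0"
  proof (rule ccontr)
    assume "\<not> ?thesis"
    then obtain zs where zs: "\<And>i j. j < n \<Longrightarrow> norm (zs i j - z0 j) < e / real (Suc i)" "\<And>i. rho n (zs i) \<le> 0"
      by (simp add: not_less) metis
    have lim: "(\<lambda>i. zs i j) \<longlonglongrightarrow> z0 j" if "j < n" for j
      by (rule LIMSEQ_if_norm_less[OF zs(1)[OF that]])
    have "(\<lambda>i. rho n (zs i)) \<longlonglongrightarrow> rho n z0" by (rule tendsto_rho[OF n lim])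
    then have "rho n z0 \<le> 0" using zs(2) by (intro LIMSEQ_le_const2) auto
    then show False using rho_pos[OF z0] by simp
  qed
  then obtain i where i: "\<And>z. z \<in> space (lebC n) \<Longrightarrow> (\<And>j. j < n \<Longrightarrow> norm (z j - z0 j) < e / real (Suc i)) \<Longrightarrow> rho n z > 0"
    by blast
  define d where "d = e / real (Suc i)"
  have d: "d > 0" "d \<le> e" using e by (auto simp: d_def field_simps)
  define Q where "Q = PiE {..<n} (\<lambda>j. ball (z0 j) d)"
  have Qs: "Q \<in> sets (lebC n)"
    unfolding Q_def lebC_def by (rule sets_PiM_I_finite) auto
  have "emeasure (lebC n) Q = (\<Prod>j<n. emeasure lborel (ball (z0 j) d))"
    unfolding Q_def lebC_def by (rule lebC.emeasure_PiM) auto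
  also have "\<dots> \<noteq> 0"
  proof -
    have "emeasure lborel (ball (z0 j) d) \<noteq> 0" for j
      using open_not_negligible[of "ball (z0 j) d"] d
      by (auto simp: negligible_iff_null_sets null_sets_def)
    then show ?thesis by simp
  qed
  finally have Q0: "emeasure (lebC n) Q \<noteq> 0" .
  have "\<exists>z\<in>Q. z \<in> tube n \<longrightarrow> P z"
  proof (rule ccontr)
    assume *: "\<not> ?thesis"
    have "AE z in lebC n. z \<in> tube n \<longrightarrow> P z" using ae n by (simp add: AE_dVa_iff)
    then have "AE z in lebC n. z \<notin> Q" by eventually_elim (use * in blast)
    then show False using Q0 Qs by (simp add: AE_iff_null_sets[symmetric] null_sets_def)
  qed
  then obtain z where z: "z \<in> Q" "z \<in> tube n \<longrightarrow> P z" by blast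
  have near: "norm (z j - z0 j) < d" if "j < n" for j
  proof -
    have "z j \<in> ball (z0 j) d" using z(1) that by (auto simp: Q_def PiE_iff)
    then show ?thesis by (simp add: dist_norm norm_minus_commute)
  qed
  have zsp: "z \<in> space (lebC n)" using z(1) by (auto simp: Q_def lebC_def space_PiM)
  have "rho n z > 0" by (rule i[OF zsp]) (use near in \<open>simp add: d_def\<close>)
  then have "z \<in> tube n" using zsp by (simp add: tube_eq)
  moreover have "norm (z j - z0 j) < e" if "j < n" for j using near[OF that] d by simp
  ultimately show ?thesis using z(2) by (intro that) auto
qed

text \<open>The essential supremum exceeds \<open>y\<close> exactly when the superlevel set has
  positive measure, and the measure of a section of a measurable set depends measurably on the
  parameter.\<close>

lemma measurable_esssup_section:
  assumes n: "n \<ge> 1" and [measurable]: "g \<in> borel_measurable (lebC n \<Otimes>\<^sub>M lebC n)"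
  shows "(\<lambda>w. esssup (dVa n \<alpha>) (\<lambda>z. g (z, w) :: ennreal)) \<in> borel_measurable (lebC n)"
proof (rule borel_measurableI_greater)
  fix y :: ennreal
  interpret sigma_finite_measure "dVa n \<alpha>" by (rule sigma_finite_dVa[OF n])
  have gm[measurable]: "(\<lambda>z. g (z, w)) \<in> borel_measurable (dVa n \<alpha>)" if "w \<in> space (lebC n)" for w
    using that by measurable
  have iff: "y < esssup (dVa n \<alpha>) (\<lambda>z. g (z, w)) \<longleftrightarrow> emeasure (dVa n \<alpha>) {z \<in> space (lebC n). g (z, w) > y} \<noteq> 0"
    if w: "w \<in> space (lebC n)" for w
  proof
    assume "y < esssup (dVa n \<alpha>) (\<lambda>z. g (z, w))"
    from esssup_pos_measure[OF gm[OF w] this] show "emeasure (dVa n \<alpha>) {z \<in> space (lebC n). g (z, w) > y} \<noteq> 0"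
      by simp
  next
    assume a: "emeasure (dVa n \<alpha>) {z \<in> space (lebC n). g (z, w) > y} \<noteq> 0"
    show "y < esssup (dVa n \<alpha>) (\<lambda>z. g (z, w))"
    proof (rule ccontr)
      assume "\<not> ?thesis"
      then have "AE z in dVa n \<alpha>. g (z, w) \<le> y"
        using esssup_AE[where M = "dVa n \<alpha>" and f = "\<lambda>z. g (z, w)"] by (auto elim!: eventually_mono)
      then show False using a gm[OF w]
        by (subst (asm) AE_iff_measurable[OF _ refl]) (auto simp: not_le)
    qed
  qed
  \<comment> \<open>The coordinates are swapped because sections are taken by fixing the first
    component, which here has to be \<open>w\<close>.\<close>
  define Q where "Q = {p \<in> space (lebC n \<Otimes>\<^sub>M dVa n \<alpha>). g (snd p, fst p) > y}"
  have "Q \<in> sets (lebC n \<Otimes>\<^sub>M dVa n \<alpha>)" unfolding Q_def by measurable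
  from measurable_emeasure_Pair[OF this] have [measurable]: "(\<lambda>w. emeasure (dVa n \<alpha>) (Pair w -` Q)) \<in> borel_measurable (lebC n)" .
  have "{w \<in> space (lebC n). y < esssup (dVa n \<alpha>) (\<lambda>z. g (z, w))} = {w \<in> space (lebC n). emeasure (dVa n \<alpha>) (Pair w -` Q) \<noteq> 0}"
    using iff by (auto simp: Q_def space_pair_measure vimage_def)
  also have "\<dots> \<in> sets (lebC n)" by measurable
  finally show "{w \<in> space (lebC n). y < esssup (dVa n \<alpha>) (\<lambda>z. g (z, w))} \<in> sets (lebC n)" .
qed

lemma sets_dV2 [measurable_cong, simp]: "sets (dV2 n) = sets (lebC n \<Otimes>\<^sub>M lebC n)"
  unfolding dV2_def by (rule sets_pair_measure_cong) auto

lemma space_dV2 [simp]: "space (dV2 n) = space (lebC n \<Otimes>\<^sub>M lebC n)"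
  by (rule sets_eq_imp_space_eq) simp

text \<open>The principal logarithm jumps across the negative axis, so continuity gives
  measurability off the nonpositive reals only; on them it is replaced by the formula
  \<open>ln (norm z) + \<i> * pi\<close>. The origin is a separate case of
  \<open>powr\<close>.\<close>

lemma measurable_powr_complex [measurable (raw)]:
  fixes c :: complex
  assumes [measurable]: "f \<in> borel_measurable M"
  shows "(\<lambda>x. f x powr c) \<in> borel_measurable M"
proof -
  let ?N = "\<real>\<^sub>\<le>\<^sub>0 :: complex set"
  have N[measurable]: "?N \<in> sets borel" by (intro borel_closed closed_nonpos_Reals_complex)
  define g where "g z = indicator (- ?N) z *\<^sub>R Ln z + indicator ?N z *\<^sub>R (complex_of_real (ln (norm z)) + \<i> * pi)" for z :: complex
  have "(\<lambda>z. indicator (- ?N) z *\<^sub>R Ln z) \<in> borel_measurable borel"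
    using N by (intro borel_measurable_continuous_on_indicator continuous_on_Ln) auto
  then have [measurable]: "g \<in> borel_measurable borel" unfolding g_def by measurable
  have g: "Ln z = g z" if "z \<noteq> 0" for z
  proof (cases "z \<in> ?N")
    case True
    then obtain x where x: "z = of_real x" "x \<le> 0" by (auto elim: nonpos_Reals_cases)
    with that have "x < 0" by (cases "x = 0") auto
    then show ?thesis using True x Ln_of_real'[of x] by (simp add: g_def)
  qed (simp add: g_def)
  have "z powr c = (if z = 0 then 0 else exp (c * g z))" for z
    using g[of z] by (simp add: powr_def)
  then show ?thesis by simp
qed

section \<open>Sufficiency\<close>

text \<open>Only the modulus of the kernel and its continuity in the first argument matter, so the two
  operators are treated at once.\<close>

locale tube_kernel =
  fixes n :: nat and b1 b2 c1 c2 :: real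
    and K :: "(nat \<Rightarrow> complex) \<times> (nat \<Rightarrow> complex) \<Rightarrow> (nat \<Rightarrow> complex) \<times> (nat \<Rightarrow> complex) \<Rightarrow> complex"
  assumes n: "n \<ge> 1"
    and K_measurable [measurable]:
      "(\<lambda>(x, y). K x y) \<in> borel_measurable ((lebC n \<Otimes>\<^sub>M lebC n) \<Otimes>\<^sub>M (lebC n \<Otimes>\<^sub>M lebC n))"
    and norm_K: "\<lbrakk>z \<in> tube n; w \<in> tube n; u \<in> tube n; \<eta> \<in> tube n\<rbrakk> \<Longrightarrow>
      norm (K (z, w) (u, \<eta>)) =
        (rho n u powr b1 * norm (rho2 n z u) powr (- c1)) * (rho n \<eta> powr b2 * norm (rho2 n w \<eta>) powr (- c2))"
    and K_tendsto: "\<lbrakk>z \<in> tube n; w \<in> tube n; u \<in> tube n; \<eta> \<in> tube n;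
      \<And>j. j < n \<Longrightarrow> (\<lambda>i. zs i j) \<longlonglongrightarrow> z j; \<And>j. j < n \<Longrightarrow> (\<lambda>i. ws i j) \<longlonglongrightarrow> w j\<rbrakk> \<Longrightarrow>
      (\<lambda>i. K (zs i, ws i) (u, \<eta>)) \<longlonglongrightarrow> K (z, w) (u, \<eta>)"
begin

sublocale dVa: sigma_finite_measure "dVa n \<alpha>" for \<alpha>
  using n by (rule sigma_finite_dVa)

sublocale dVa: pair_sigma_finite "dVa n \<alpha>" "dVa n \<beta>" for \<alpha> \<beta> ..

lemma AE_tube: "AE z in dVa n \<alpha>. z \<in> tube n"
  using n by (simp add: AE_dVa_iff)

lemma AE_dV2_tube: "AE x in dV2 n. fst x \<in> tube n \<and> snd x \<in> tube n"
  unfolding dV2_def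
proof (rule dVa.AE_pair_measure)
  show "{x \<in> space (dVa n 0 \<Otimes>\<^sub>M dVa n 0). fst x \<in> tube n \<and> snd x \<in> tube n} \<in> sets (dVa n 0 \<Otimes>\<^sub>M dVa n 0)"
    using n by measurable
  show "AE x in dVa n 0. AE y in dVa n 0. fst (x, y) \<in> tube n \<and> snd (x, y) \<in> tube n"
    using AE_tube[of 0] by (auto elim!: eventually_mono)
qed

lemma K_section_measurable [measurable]:
  "x \<in> space (lebC n \<Otimes>\<^sub>M lebC n) \<Longrightarrow> K x \<in> borel_measurable (lebC n \<Otimes>\<^sub>M lebC n)"
  using measurable_compose[OF measurable_Pair1' K_measurable] by simp

text \<open>Split the power into exponents \<open>- a\<close> and \<open>- (b - \<alpha>)\<close>,
  both nonpositive, and bound the norm below by \<open>rho n w / 2\<close> in the first factor and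
  by \<open>rho n \<eta> / 2\<close> in the second.\<close>

lemma rho2_weight_le:
  assumes w: "w \<in> tube n" and h: "\<eta> \<in> tube n" and a: "a \<ge> 0" "b \<ge> \<alpha>"
  shows "rho n \<eta> powr b * norm (rho2 n w \<eta>) powr (- (a + b - \<alpha>))
    \<le> 2 powr (a + b - \<alpha>) * rho n w powr (- a) * rho n \<eta> powr \<alpha>"
proof -
  have p: "rho n w > 0" "rho n \<eta> > 0" using w h by (auto intro: rho_pos)
  define N where "N = norm (rho2 n w \<eta>)"
  have N: "N \<ge> rho n w / 2" "N \<ge> rho n \<eta> / 2" "N > 0"
    using norm_rho2_ge[of n w \<eta>] p by (auto simp: N_def)
  have "N powr (- (a + b - \<alpha>)) = N powr (- a) * N powr (- (b - \<alpha>))"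
    by (simp add: powr_add[symmetric] algebra_simps)
  also have "\<dots> \<le> (rho n w / 2) powr (- a) * (rho n \<eta> / 2) powr (- (b - \<alpha>))"
    using N p a by (intro mult_mono powr_mono2') auto
  also have "\<dots> = 2 powr (a + b - \<alpha>) * rho n w powr (- a) * rho n \<eta> powr (\<alpha> - b)"
    using p by (simp add: powr_divide powr_minus powr_diff powr_add field_simps)
  finally have "rho n \<eta> powr b * N powr (- (a + b - \<alpha>))
     \<le> rho n \<eta> powr b * (2 powr (a + b - \<alpha>) * rho n w powr (- a) * rho n \<eta> powr (\<alpha> - b))"
    by (intro mult_left_mono) auto
  also have "\<dots> = 2 powr (a + b - \<alpha>) * rho n w powr (- a) * rho n \<eta> powr \<alpha>"
    using p by (simp add: powr_diff)
  finally show ?thesis by (simp add: N_def)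
qed

text \<open>Take absolute values and pull the essential supremum \<open>F \<eta>\<close> out of the
  integral over \<open>u\<close>. That integral is \<open>h * rho n z powr (- a1)\<close>, and
  \<open>rho2_weight_le\<close> turns the remaining kernel into the weight
  \<open>rho n \<eta> powr \<alpha>2\<close> of the mixed norm. The prefactor cancels what is
  left.\<close>

lemma bounded_if:
  assumes a: "a1 > 0" "a2 \<ge> 0" "b1 > -1" "b2 \<ge> \<alpha>2"
    and c1: "c1 = real n + 1 + a1 + b1" and c2: "c2 = a2 + b2 - \<alpha>2"
  shows "bounded_inf1_to_inf n \<alpha>1 \<alpha>2 (prefac n a1 a2) K"
proof -
  obtain H where H: "H > 0" "H < top \<longleftrightarrow> b1 > -1 \<and> c1 > real n + 1 + b1"
    "\<And>z. z \<in> tube n \<Longrightarrow> (\<integral>\<^sup>+ u. ennreal (rho n u powr b1 * norm (rho2 n z u) powr (- c1)) \<partial>dVa n 0)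
       = H * ennreal (rho n z powr (real n + 1 + b1 - c1))"
    using nn_integral_rho2_powr[OF n, where b = b1 and c = c1] by blast
  have "H < top" using H(2) a c1 by simp
  then obtain h where h: "H = ennreal h" "h \<ge> 0" by (cases H) auto
  show ?thesis unfolding bounded_inf1_to_inf_def
  proof (intro exI[of _ "h * 2 powr c2"] allI impI, elim conjE)
    fix f assume f[measurable]: "f \<in> borel_measurable (lebC n \<Otimes>\<^sub>M lebC n)"
      and fin: "mixnorm_inf1 n \<alpha>1 \<alpha>2 f < \<infinity>"
    define F where "F \<eta> = esssup (dVa n \<alpha>1) (\<lambda>z. ennreal (norm (f (z, \<eta>))))" for \<eta>
    have Fm[measurable]: "F \<in> borel_measurable (lebC n)"
      unfolding F_def by (rule measurable_esssup_section[OF n, of "\<lambda>p. ennreal (norm (f p))"]) measurable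
    define N where "N = mixnorm_inf1 n \<alpha>1 \<alpha>2 f"
    have N: "N = (\<integral>\<^sup>+ \<eta>. ennreal (rho n \<eta> powr \<alpha>2) * F \<eta> \<partial>dVa n 0)"
      unfolding N_def mixnorm_inf1_def F_def[symmetric] by (rule nn_integral_dVa_shift[OF n Fm])
    \<comment> \<open>The supremum is essential for the weight \<open>\<alpha>1\<close> while the
      integral is unweighted; the common null sets reconcile the two.\<close>
    have F_AE: "AE u in dVa n 0. ennreal (norm (f (u, \<eta>))) \<le> F \<eta>" for \<eta>
      using esssup_AE[where M = "dVa n \<alpha>1" and f = "\<lambda>z. ennreal (norm (f (z, \<eta>)))"]
      unfolding F_def AE_dVa_iff[OF n] .
    have bound: "(\<integral>\<^sup>+ y. ennreal (norm (K (z, w) y * f y)) \<partial>dV2 n)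
        \<le> ennreal (h * 2 powr c2 * rho n z powr (- a1) * rho n w powr (- a2)) * N"
      if zw: "z \<in> tube n" "w \<in> tube n" for z w
    proof -
      let ?k1 = "\<lambda>u. rho n u powr b1 * norm (rho2 n z u) powr (- c1)"
      let ?k2 = "\<lambda>\<eta>. rho n \<eta> powr b2 * norm (rho2 n w \<eta>) powr (- c2)"
      have sp[measurable]: "z \<in> space (lebC n)" "w \<in> space (lebC n)" "(z, w) \<in> space (lebC n \<Otimes>\<^sub>M lebC n)"
        using zw by (auto simp: tube_eq space_pair_measure)
      have [measurable]: "?k1 \<in> borel_measurable (lebC n)" using n sp by measurable
      have [measurable]: "K (z, w) \<in> borel_measurable (lebC n \<Otimes>\<^sub>M lebC n)"
        using sp by measurable
      have "(\<integral>\<^sup>+ y. ennreal (norm (K (z, w) y * f y)) \<partial>dV2 n)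
          = (\<integral>\<^sup>+ \<eta>. \<integral>\<^sup>+ u. ennreal (norm (K (z, w) (u, \<eta>) * f (u, \<eta>))) \<partial>dVa n 0 \<partial>dVa n 0)"
        unfolding dV2_def by (rule dVa.nn_integral_snd[symmetric]) measurable
      also have "\<dots> \<le> (\<integral>\<^sup>+ \<eta>. ennreal (h * 2 powr c2 * rho n z powr (- a1) * rho n w powr (- a2)) * (ennreal (rho n \<eta> powr \<alpha>2) * F \<eta>) \<partial>dVa n 0)"
      proof (rule nn_integral_mono_AE, use AE_tube[of 0] in eventually_elim)
        fix \<eta> assume \<eta>: "\<eta> \<in> tube n"
        have "(\<integral>\<^sup>+ u. ennreal (norm (K (z, w) (u, \<eta>) * f (u, \<eta>))) \<partial>dVa n 0)
           \<le> (\<integral>\<^sup>+ u. ennreal (?k2 \<eta>) * F \<eta> * ennreal (?k1 u) \<partial>dVa n 0)"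
        proof (rule nn_integral_mono_AE, use AE_tube[of 0] F_AE[of \<eta>] in eventually_elim)
          fix u assume u: "u \<in> tube n" and le: "ennreal (norm (f (u, \<eta>))) \<le> F \<eta>"
          have "ennreal (norm (K (z, w) (u, \<eta>) * f (u, \<eta>))) = ennreal (?k2 \<eta>) * ennreal (norm (f (u, \<eta>))) * ennreal (?k1 u)"
            by (simp add: norm_mult norm_K[OF zw u \<eta>] ennreal_mult ac_simps)
          also have "\<dots> \<le> ennreal (?k2 \<eta>) * F \<eta> * ennreal (?k1 u)"
            by (intro mult_right_mono mult_left_mono le) auto
          finally show "ennreal (norm (K (z, w) (u, \<eta>) * f (u, \<eta>))) \<le> ennreal (?k2 \<eta>) * F \<eta> * ennreal (?k1 u)" .
        qed
        also have "\<dots> = ennreal (?k2 \<eta>) * F \<eta> * (H * ennreal (rho n z powr (real n + 1 + b1 - c1)))"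
          by (subst nn_integral_cmult) (simp_all only: H(3)[OF zw(1)], measurable)
        also have "real n + 1 + b1 - c1 = - a1" using c1 by simp
        also have "ennreal (?k2 \<eta>) * F \<eta> * (H * ennreal (rho n z powr (- a1)))
           \<le> ennreal (2 powr c2 * rho n w powr (- a2) * rho n \<eta> powr \<alpha>2) * F \<eta> * (H * ennreal (rho n z powr (- a1)))"
          using rho2_weight_le[OF zw(2) \<eta> a(2,4)] c2 by (intro mult_right_mono ennreal_leI) auto
        also have "\<dots> = ennreal (h * 2 powr c2 * rho n z powr (- a1) * rho n w powr (- a2)) * (ennreal (rho n \<eta> powr \<alpha>2) * F \<eta>)"
          using h by (simp add: ennreal_mult ac_simps)
        finally show "(\<integral>\<^sup>+ u. ennreal (norm (K (z, w) (u, \<eta>) * f (u, \<eta>))) \<partial>dVa n 0) \<le>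
           ennreal (h * 2 powr c2 * rho n z powr (- a1) * rho n w powr (- a2)) * (ennreal (rho n \<eta> powr \<alpha>2) * F \<eta>)" .
      qed
      also have "\<dots> = ennreal (h * 2 powr c2 * rho n z powr (- a1) * rho n w powr (- a2)) * N"
        using n unfolding N by (subst nn_integral_cmult) auto
      finally show ?thesis .
    qed
    have integrable: "integrable (dV2 n) (\<lambda>y. K (z, w) y * f y)" if zw: "z \<in> tube n" "w \<in> tube n" for z w
    proof (rule integrableI_bounded)
      have [measurable]: "K (z, w) \<in> borel_measurable (lebC n \<Otimes>\<^sub>M lebC n)"
        using zw by (intro K_section_measurable) (auto simp: tube_eq space_pair_measure)
      show "(\<lambda>y. K (z, w) y * f y) \<in> borel_measurable (dV2 n)" by measurable
      show "(\<integral>\<^sup>+ y. ennreal (norm (K (z, w) y * f y)) \<partial>dV2 n) < \<infinity>"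
        using fin by (intro le_less_trans[OF bound[OF zw]]) (auto simp: N_def ennreal_mult_less_top)
    qed
    show "(AE x in dV2 n. integrable (dV2 n) (\<lambda>y. K x y * f y)) \<and>
        esssup (dV2 n) (\<lambda>x. ennreal (norm (intop (prefac n a1 a2) K (dV2 n) f x)))
          \<le> ennreal (h * 2 powr c2) * mixnorm_inf1 n \<alpha>1 \<alpha>2 f"
    proof (intro conjI esssup_I)
      show "AE x in dV2 n. integrable (dV2 n) (\<lambda>y. K x y * f y)"
        using AE_dV2_tube by eventually_elim (metis integrable prod.collapse)
      have [measurable]: "prefac n a1 a2 \<in> borel_measurable (dV2 n)"
        unfolding prefac_def case_prod_beta using n by measurable
      interpret dV2: sigma_finite_measure "dV2 n"
        unfolding dV2_def by (intro sigma_finite_pair_measure dVa.sigma_finite_measure_axioms)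
      have "(\<lambda>(x, y). K x y * f y) \<in> borel_measurable (dV2 n \<Otimes>\<^sub>M dV2 n)"
        by measurable
      then have [measurable]: "(\<lambda>x. LINT y|dV2 n. K x y * f y) \<in> borel_measurable (dV2 n)"
        by (rule dV2.borel_measurable_lebesgue_integral)
      show "(\<lambda>x. ennreal (norm (intop (prefac n a1 a2) K (dV2 n) f x))) \<in> borel_measurable (dV2 n)"
        unfolding intop_def by measurable
      show "AE x in dV2 n. ennreal (norm (intop (prefac n a1 a2) K (dV2 n) f x)) \<le> ennreal (h * 2 powr c2) * mixnorm_inf1 n \<alpha>1 \<alpha>2 f"
        using AE_dV2_tube
      proof eventually_elim
        fix x assume "fst x \<in> tube n \<and> snd x \<in> tube n"
        then obtain z w where x: "x = (z, w)" and zw: "z \<in> tube n" "w \<in> tube n" by (cases x) auto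
        have p: "rho n z > 0" "rho n w > 0" using zw by (auto intro: rho_pos)
        have "ennreal (norm (intop (prefac n a1 a2) K (dV2 n) f x))
          = ennreal (rho n z powr a1 * rho n w powr a2) * ennreal (norm (LINT y|dV2 n. K (z, w) y * f y))"
          by (simp add: intop_def prefac_def x norm_mult ennreal_mult)
        also have "\<dots> \<le> ennreal (rho n z powr a1 * rho n w powr a2) *
            (ennreal (h * 2 powr c2 * rho n z powr (- a1) * rho n w powr (- a2)) * N)"
          by (intro mult_left_mono order_trans[OF integral_norm_bound_ennreal[OF integrable[OF zw]] bound[OF zw]]) auto
        also have "\<dots> = ennreal ((rho n z powr a1 * rho n w powr a2) * (h * 2 powr c2 * rho n z powr (- a1) * rho n w powr (- a2))) * N"
          using h by (simp add: ennreal_mult ac_simps)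
        also have "(rho n z powr a1 * rho n w powr a2) * (h * 2 powr c2 * rho n z powr (- a1) * rho n w powr (- a2)) = h * 2 powr c2"
          using p by (simp add: powr_minus field_simps)
        finally show "ennreal (norm (intop (prefac n a1 a2) K (dV2 n) f x)) \<le> ennreal (h * 2 powr c2) * mixnorm_inf1 n \<alpha>1 \<alpha>2 f"
          by (simp add: N_def)
      qed
    qed
  qed
qed

end

section \<open>The two kernels as instances of the locale\<close>

lemma tube_kernel_kerS:
  assumes n: "n \<ge> 1"
  shows "tube_kernel n b1 b2 c1 c2 (kerS n b1 b2 c1 c2)"
proof
  show "(\<lambda>(x, y). kerS n b1 b2 c1 c2 x y) \<in> borel_measurable ((lebC n \<Otimes>\<^sub>M lebC n) \<Otimes>\<^sub>M lebC n \<Otimes>\<^sub>M lebC n)"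
    unfolding kerS_def case_prod_beta using n by measurable
next
  fix z w u \<eta> assume "z \<in> tube n" "w \<in> tube n" "u \<in> tube n" "\<eta> \<in> tube n"
  then show "norm (kerS n b1 b2 c1 c2 (z, w) (u, \<eta>)) =
        (rho n u powr b1 * norm (rho2 n z u) powr (- c1)) * (rho n \<eta> powr b2 * norm (rho2 n w \<eta>) powr (- c2))"
    by (simp add: kerS_def norm_mult norm_divide powr_minus field_simps)
next
  fix z w u \<eta> zs ws
  assume t: "z \<in> tube n" "w \<in> tube n" "u \<in> tube n" "\<eta> \<in> tube n"
    and l: "\<And>j. j < n \<Longrightarrow> (\<lambda>i. zs i j) \<longlonglongrightarrow> z j" "\<And>j. j < n \<Longrightarrow> (\<lambda>i. ws i j) \<longlonglongrightarrow> w j"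
  have "(\<lambda>i. rho2 n (zs i) u) \<longlonglongrightarrow> rho2 n z u" "(\<lambda>i. rho2 n (ws i) \<eta>) \<longlonglongrightarrow> rho2 n w \<eta>"
    using l by (intro tendsto_rho2[OF n]; simp)+
  then show "(\<lambda>i. kerS n b1 b2 c1 c2 (zs i, ws i) (u, \<eta>)) \<longlonglongrightarrow> kerS n b1 b2 c1 c2 (z, w) (u, \<eta>)"
    unfolding kerS_def prod.case using t by (intro tendsto_intros) (auto simp: rho2_nonzero)
qed (use n in simp)

text \<open>A real exponent makes the modulus of the principal power the power of the modulus.
  Continuity holds because \<open>rho2\<close> has positive real part on the tube and so stays off
  the branch cut.\<close>

lemma tube_kernel_kerT:
  assumes n: "n \<ge> 1"
  shows "tube_kernel n b1 b2 c1 c2 (kerT n b1 b2 c1 c2)"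
proof
  show "(\<lambda>(x, y). kerT n b1 b2 c1 c2 x y) \<in> borel_measurable ((lebC n \<Otimes>\<^sub>M lebC n) \<Otimes>\<^sub>M lebC n \<Otimes>\<^sub>M lebC n)"
    unfolding kerT_def case_prod_beta using n by measurable
next
  fix z w u \<eta> assume "z \<in> tube n" "w \<in> tube n" "u \<in> tube n" "\<eta> \<in> tube n"
  then show "norm (kerT n b1 b2 c1 c2 (z, w) (u, \<eta>)) =
        (rho n u powr b1 * norm (rho2 n z u) powr (- c1)) * (rho n \<eta> powr b2 * norm (rho2 n w \<eta>) powr (- c2))"
    by (simp add: kerT_def norm_mult norm_divide norm_powr_real_powr' powr_minus field_simps)
next
  fix z w u \<eta> zs ws
  assume t: "z \<in> tube n" "w \<in> tube n" "u \<in> tube n" "\<eta> \<in> tube n"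
    and l: "\<And>j. j < n \<Longrightarrow> (\<lambda>i. zs i j) \<longlonglongrightarrow> z j" "\<And>j. j < n \<Longrightarrow> (\<lambda>i. ws i j) \<longlonglongrightarrow> w j"
  have np: "rho2 n z u \<notin> \<real>\<^sub>\<le>\<^sub>0" "rho2 n w \<eta> \<notin> \<real>\<^sub>\<le>\<^sub>0"
    using Re_rho2_pos t by (fastforce elim!: nonpos_Reals_cases)+
  have "(\<lambda>i. rho2 n (zs i) u) \<longlonglongrightarrow> rho2 n z u" "(\<lambda>i. rho2 n (ws i) \<eta>) \<longlonglongrightarrow> rho2 n w \<eta>"
    using l by (intro tendsto_rho2[OF n]; simp)+
  then show "(\<lambda>i. kerT n b1 b2 c1 c2 (zs i, ws i) (u, \<eta>)) \<longlonglongrightarrow> kerT n b1 b2 c1 c2 (z, w) (u, \<eta>)"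
    unfolding kerT_def prod.case using np t by (intro tendsto_intros) (auto simp: rho2_nonzero)
qed (use n in simp)

section \<open>Necessity\<close>

text \<open>An exhaustion of the tube by bounded sets that stay away from its boundary.
  \<open>Suc k\<close> keeps the lower bound for \<open>rho\<close> positive already at
  \<open>k = 0\<close>.\<close>

definition tube_box :: "nat \<Rightarrow> nat \<Rightarrow> (nat \<Rightarrow> complex) set" where
  "tube_box n k = {u \<in> space (lebC n). (\<forall>j<n. norm (u j) \<le> real (Suc k)) \<and> 1 / real (Suc k) \<le> rho n u}"

lemma tube_box_subset: "tube_box n k \<subseteq> tube n"
proof
  fix u assume u: "u \<in> tube_box n k"
  have "0 < 1 / real (Suc k)" by simp
  also have "\<dots> \<le> rho n u" using u by (simp add: tube_box_def)
  finally show "u \<in> tube n" using u by (simp add: tube_box_def tube_eq)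
qed

lemma sets_tube_box [measurable]:
  assumes "n \<ge> 1"
  shows "tube_box n k \<in> sets (lebC n)"
proof -
  have [measurable]: "(\<lambda>u. u j) \<in> borel_measurable (lebC n)" if "j < n" for j
    using measurable_lebC_component[OF measurable_ident that] by simp
  have "{u \<in> space (lebC n). \<forall>j\<in>{..<n}. norm (u j) \<le> real (Suc k)} \<in> sets (lebC n)"
    by (intro sets.sets_Collect_finite_All) auto
  moreover have "{u \<in> space (lebC n). 1 / real (Suc k) \<le> rho n u} \<in> sets (lebC n)"
    using assms by measurable
  moreover have "tube_box n k = {u \<in> space (lebC n). \<forall>j\<in>{..<n}. norm (u j) \<le> real (Suc k)}
      \<inter> {u \<in> space (lebC n). 1 / real (Suc k) \<le> rho n u}"
    by (auto simp: tube_box_def)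
  ultimately show ?thesis by simp
qed

lemma incseq_tube_box: "incseq (tube_box n)"
proof (rule incseq_SucI, rule subsetI)
  fix k u assume u: "u \<in> tube_box n k"
  have "1 / real (Suc (Suc k)) \<le> 1 / real (Suc k)" by (intro divide_left_mono) auto
  with u show "u \<in> tube_box n (Suc k)" by (fastforce simp: tube_box_def)
qed

lemma UN_tube_box: "(\<Union>k. tube_box n k) = tube n"
proof (rule antisym)
  show "(\<Union>k. tube_box n k) \<subseteq> tube n" using tube_box_subset by blast
  show "tube n \<subseteq> (\<Union>k. tube_box n k)"
  proof
    fix u assume u: "u \<in> tube n"
    obtain k :: nat where k: "real k > (\<Sum>j<n. norm (u j)) + 1 / rho n u" using reals_Archimedean2 by blast
    have p: "rho n u > 0" using u by (rule rho_pos)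
    have "norm (u j) \<le> real (Suc k)" if "j < n" for j
    proof -
      have "norm (u j) \<le> (\<Sum>j<n. norm (u j))" using that by (intro member_le_sum) auto
      moreover have "1 / rho n u > 0" using p by simp
      ultimately have "norm (u j) \<le> real k" using k by linarith
      then show ?thesis by simp
    qed
    moreover have "1 / real (Suc k) \<le> rho n u"
    proof -
      have "1 / rho n u \<le> real (Suc k)"
        using k sum_nonneg[of "{..<n}" "\<lambda>j. norm (u j)"] by simp
      then show ?thesis using p by (simp add: field_simps)
    qed
    ultimately show "u \<in> (\<Union>k. tube_box n k)" using u by (auto simp: tube_box_def tube_eq)
  qed
qed

lemma rho_le_tube_box:
  assumes n: "n \<ge> 1" and u: "u \<in> tube_box n k"
  shows "rho n u \<le> real (Suc k)"
proof -
  have "rho n u \<le> Im (u (n - 1))" by (simp add: rho_def sum_nonneg)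
  also have "\<dots> \<le> norm (u (n - 1))" using abs_Im_le_cmod[of "u (n - 1)"] by linarith
  also have "\<dots> \<le> real (Suc k)" using u n by (simp add: tube_box_def)
  finally show ?thesis .
qed

lemma rho_powr_le_tube_box:
  assumes n: "n \<ge> 1" and u: "u \<in> tube_box n k"
  shows "rho n u powr p \<le> (1 / real (Suc k)) powr p + real (Suc k) powr p"
  using u rho_le_tube_box[OF n u] by (intro powr_le_sum_endpoints) (auto simp: tube_box_def)

text \<open>The box lies in a polydisc of finite volume, and the density is bounded on it.\<close>

lemma emeasure_dVa_tube_box_finite:
  assumes n: "n \<ge> 1"
  shows "emeasure (dVa n \<alpha>) (tube_box n k) < top"
proof -
  let ?R = "real (Suc k)"
  have box: "emeasure (lebC n) (tube_box n k) < top"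
  proof -
    have "emeasure (lebC n) (tube_box n k) \<le> emeasure (lebC n) (PiE {..<n} (\<lambda>_. cball 0 ?R))"
      unfolding lebC_def
      by (intro emeasure_mono sets_PiM_I_finite) (auto simp: tube_box_def lebC_def space_PiM PiE_iff extensional_def)
    also have "\<dots> = (\<Prod>j<n. emeasure lborel (cball (0::complex) ?R))"
      unfolding lebC_def by (rule lebC.emeasure_PiM) auto
    also have "\<dots> < top"
      using emeasure_bounded_finite[of "cball (0::complex) ?R"]
      by (intro less_top[THEN iffD1]) (auto simp: ennreal_prod_eq_top less_top power_less_top_ennreal)
    finally show ?thesis .
  qed
  have "emeasure (dVa n \<alpha>) (tube_box n k) = (\<integral>\<^sup>+ z. indicator (tube_box n k) z \<partial>dVa n \<alpha>)"
    using n by simp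
  also have "\<dots> = (\<integral>\<^sup>+ z\<in>tube n. ennreal (rho n z powr \<alpha>) * indicator (tube_box n k) z \<partial>lebC n)"
    using n by (subst nn_integral_dVa) auto
  also have "\<dots> \<le> (\<integral>\<^sup>+ z. ennreal ((1 / ?R) powr \<alpha> + ?R powr \<alpha>) * indicator (tube_box n k) z \<partial>lebC n)"
    using rho_powr_le_tube_box[OF n] by (intro nn_integral_mono) (auto simp: indicator_def simp del: ennreal_plus intro!: ennreal_leI)
  also have "\<dots> = ennreal ((1 / ?R) powr \<alpha> + ?R powr \<alpha>) * emeasure (lebC n) (tube_box n k)"
    using n by (subst nn_integral_cmult_indicator) auto
  also have "\<dots> < top" using box by (simp add: ennreal_mult_less_top)
  finally show ?thesis .
qed

section \<open>Testing the operator bound on phase-cancelling functions\<close>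

context tube_kernel
begin

text \<open>Supplies the dominating constant for the dominated convergence argument: with the first
  points near \<open>(z0, w0)\<close> and the second ones in boxes, \<open>rho\<close> and
  \<open>norm (rho2 n z u)\<close> range over compact intervals of positive reals.\<close>

lemma K_bounded_near:
  assumes "z0 \<in> tube n" "w0 \<in> tube n"
  obtains M where "\<And>z w u \<eta>. \<lbrakk>z \<in> tube n; w \<in> tube n; \<And>j. j < n \<Longrightarrow> norm (z j - z0 j) \<le> 1;
    \<And>j. j < n \<Longrightarrow> norm (w j - w0 j) \<le> 1; u \<in> tube_box n k; \<eta> \<in> tube_box n l\<rbrakk>
    \<Longrightarrow> norm (K (z, w) (u, \<eta>)) \<le> M"
proof -
  have ex: "\<exists>M. \<forall>z u. z \<in> tube n \<longrightarrow> (\<forall>j<n. norm (z j - z0 j) \<le> 1) \<longrightarrow> u \<in> tube_box n k \<longrightarrow>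
     rho n u powr b * norm (rho2 n z u) powr (- c) \<le> M" if z0: "z0 \<in> tube n" for z0 b c k
  proof -
    define Z where "Z = (\<Sum>j<n. norm (z0 j)) + 1 + real (Suc k)"
    define R where "R = real n * Z\<^sup>2 + Z"
    \<comment> \<open>\<open>?l\<close> is half of the lower bound \<open>?r\<close> for
      \<open>rho n u\<close>, as \<open>norm_rho2_ge\<close> provides; \<open>R\<close> is the bound
      of \<open>norm_rho2_le\<close> for points with coordinates of size at most
      \<open>Z\<close>.\<close>
    let ?r = "1 / real (Suc k)" and ?l = "1 / (2 * real (Suc k))"
    have "rho n u powr b * norm (rho2 n z u) powr (- c) \<le> (?r powr b + real (Suc k) powr b) * (?l powr (- c) + R powr (- c))"
      if z: "z \<in> tube n" "\<forall>j<n. norm (z j - z0 j) \<le> 1" and u: "u \<in> tube_box n k" for z u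
    proof (intro mult_mono rho_powr_le_tube_box[OF n u] powr_le_sum_endpoints)
      show "0 < ?l" by simp
      have r: "?r \<le> rho n u" using u unfolding tube_box_def by blast
      have "?l = ?r / 2" by simp
      also have "\<dots> \<le> (rho n z + rho n u) / 2"
        by (intro divide_right_mono add_increasing r less_imp_le[OF rho_pos[OF z(1)]]) simp
      also have "\<dots> \<le> norm (rho2 n z u)" by (rule norm_rho2_ge)
      finally show "?l \<le> norm (rho2 n z u)" .
      show "norm (rho2 n z u) \<le> R" unfolding R_def
      proof (rule norm_rho2_le[OF n])
        fix j assume j: "j < n"
        have 1: "norm (z0 j) \<le> (\<Sum>j<n. norm (z0 j))" using j by (intro member_le_sum) auto
        have "norm (z j) \<le> norm (z0 j) + norm (z j - z0 j)" using norm_triangle_sub[of "z j" "z0 j"] by simp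
        moreover have "norm (z j - z0 j) \<le> 1" using z(2) j by blast
        ultimately show "norm (z j) \<le> Z" using 1 by (simp add: Z_def)
        have "norm (u j) \<le> real (Suc k)" using u j by (simp add: tube_box_def)
        then show "norm (u j) \<le> Z" using 1 norm_ge_zero[of "z0 j"] unfolding Z_def by linarith
      qed
    qed (auto)
    then show ?thesis by blast
  qed
  obtain M1 where M1: "\<And>z u. z \<in> tube n \<Longrightarrow> (\<forall>j<n. norm (z j - z0 j) \<le> 1) \<Longrightarrow> u \<in> tube_box n k \<Longrightarrow>
     rho n u powr b1 * norm (rho2 n z u) powr (- c1) \<le> M1"
    using ex[OF assms(1), of k b1 c1] by blast
  obtain M2 where M2: "\<And>z u. z \<in> tube n \<Longrightarrow> (\<forall>j<n. norm (z j - w0 j) \<le> 1) \<Longrightarrow> u \<in> tube_box n l \<Longrightarrow>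
     rho n u powr b2 * norm (rho2 n z u) powr (- c2) \<le> M2"
    using ex[OF assms(2), of l b2 c2] by blast
  show ?thesis
  proof (rule that[of "\<bar>M1\<bar> * \<bar>M2\<bar>"])
    fix z w u \<eta> assume *: "z \<in> tube n" "w \<in> tube n" "\<And>j. j < n \<Longrightarrow> norm (z j - z0 j) \<le> 1"
      "\<And>j. j < n \<Longrightarrow> norm (w j - w0 j) \<le> 1" "u \<in> tube_box n k" "\<eta> \<in> tube_box n l"
    then have t: "u \<in> tube n" "\<eta> \<in> tube n" using tube_box_subset by blast+
    show "norm (K (z, w) (u, \<eta>)) \<le> \<bar>M1\<bar> * \<bar>M2\<bar>"
      unfolding norm_K[OF *(1,2) t]
      using M1[of z u] M2[of w \<eta>] * by (intro mult_mono) (auto intro: order_trans[OF _ abs_ge_self])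
  qed
qed

text \<open>By Fubini almost every \<open>z\<close> has a full-measure set of good \<open>w\<close>.
  Such a \<open>z\<close> is chosen near \<open>z0\<close> first, then a good \<open>w\<close> near
  \<open>w0\<close>.\<close>

lemma AE_dV2_near:
  assumes ae: "AE x in dV2 n. P x" and z: "z0 \<in> tube n" "w0 \<in> tube n"
  obtains zs ws where "\<And>i. zs i \<in> tube n" "\<And>i. ws i \<in> tube n" "\<And>i. P (zs i, ws i)"
    "\<And>i j. j < n \<Longrightarrow> norm (zs i j - z0 j) \<le> 1" "\<And>i j. j < n \<Longrightarrow> norm (ws i j - w0 j) \<le> 1"
    "\<And>j. j < n \<Longrightarrow> (\<lambda>i. zs i j) \<longlonglongrightarrow> z0 j" "\<And>j. j < n \<Longrightarrow> (\<lambda>i. ws i j) \<longlonglongrightarrow> w0 j"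
proof -
  have ae': "AE z in dVa n 0. AE w in dVa n 0. P (z, w)"
    using ae unfolding dV2_def by (rule dVa.AE_pair)
  have "\<exists>z w. z \<in> tube n \<and> w \<in> tube n \<and> P (z, w) \<and> (\<forall>j<n. norm (z j - z0 j) < 1 / real (Suc i)) \<and>
    (\<forall>j<n. norm (w j - w0 j) < 1 / real (Suc i))" for i
  proof -
    have e: "1 / real (Suc i) > 0" by simp
    obtain x where x: "x \<in> tube n" "AE w in dVa n 0. P (x, w)" "\<And>j. j < n \<Longrightarrow> norm (x j - z0 j) < 1 / real (Suc i)"
      using AE_dVa_near[OF n ae' z(1) e] by blast
    obtain y where "y \<in> tube n" "P (x, y)" "\<And>j. j < n \<Longrightarrow> norm (y j - w0 j) < 1 / real (Suc i)"
      using AE_dVa_near[OF n x(2) z(2) e] by blast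
    with x show ?thesis by blast
  qed
  then obtain zs ws where s: "\<And>i. zs i \<in> tube n" "\<And>i. ws i \<in> tube n" "\<And>i. P (zs i, ws i)"
    "\<And>i j. j < n \<Longrightarrow> norm (zs i j - z0 j) < 1 / real (Suc i)" "\<And>i j. j < n \<Longrightarrow> norm (ws i j - w0 j) < 1 / real (Suc i)"
    by metis
  have one: "1 / real (Suc i) \<le> 1" for i by simp
  show ?thesis
  proof (rule that[of zs ws])
    show "norm (zs i j - z0 j) \<le> 1" "norm (ws i j - w0 j) \<le> 1" if "j < n" for i j
      using s(4,5)[OF that, of i] one[of i] by linarith+
  qed (use s in \<open>auto intro!: LIMSEQ_if_norm_less[where e = 1]\<close>)
qed

end

context tube_kernel
begin

text \<open>The test function has modulus at most the indicator of
  \<open>tube_box n k \<times> D\<close>, so its mixed norm is at most the measure of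
  \<open>D\<close>, uniformly in \<open>k\<close>. At \<open>(z, w)\<close> itself it makes the
  integrand equal to the modulus of the kernel there.\<close>

lemma nn_integral_K_le:
  assumes bd: "\<And>f. f \<in> borel_measurable (lebC n \<Otimes>\<^sub>M lebC n) \<Longrightarrow> mixnorm_inf1 n \<alpha>1 \<alpha>2 f < \<infinity> \<Longrightarrow>
      esssup (dV2 n) (\<lambda>x. ennreal (norm (intop (prefac n a1 a2) K (dV2 n) f x))) \<le> ennreal C * mixnorm_inf1 n \<alpha>1 \<alpha>2 f"
    and z: "z \<in> tube n" and w: "w \<in> tube n" and D: "D \<in> sets (lebC n)" "D \<subseteq> tube_box n l"
  shows "ennreal (rho n z powr a1 * rho n w powr a2) * (\<integral>\<^sup>+ y. ennreal (norm (K (z, w) y)) * indicator (tube_box n k \<times> D) y \<partial>dV2 n)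
     \<le> ennreal C * emeasure (dVa n \<alpha>2) D"
proof -
  let ?E = "tube_box n k \<times> D"
  note D(1)[measurable]
  have Em[measurable]: "tube_box n k \<in> sets (lebC n)" "tube_box n l \<in> sets (lebC n)" using n by auto
  \<comment> \<open>\<open>T f\<close> is only controlled almost everywhere; dominated convergence along a sequence of good points
    tending to \<open>(z, w)\<close> carries the bound to the point at which \<open>f\<close> cancels the phase.\<close>
  define f where "f y = cnj (sgn (K (z, w) y)) * indicator ?E y" for y
  have zw: "(z, w) \<in> space (lebC n \<Otimes>\<^sub>M lebC n)" using z w by (auto simp: tube_eq space_pair_measure)
  have Kzw[measurable]: "K (z, w) \<in> borel_measurable (lebC n \<Otimes>\<^sub>M lebC n)" using zw by measurable
  have [measurable]: "(\<lambda>y. cnj (sgn (K (z, w) y))) \<in> borel_measurable (lebC n \<Otimes>\<^sub>M lebC n)"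
    unfolding sgn_div_norm by (intro borel_measurable_continuous_on[where f = cnj]) (auto intro: continuous_intros)
  have fm[measurable]: "f \<in> borel_measurable (lebC n \<Otimes>\<^sub>M lebC n)"
    unfolding f_def by measurable
  have Kf: "K (z, w) y * f y = complex_of_real (norm (K (z, w) y) * indicator ?E y)" for y
  proof -
    have "v * cnj (sgn v) = complex_of_real (norm v)" for v :: complex
      by (cases "v = 0") (simp_all add: sgn_div_norm complex_norm_square[symmetric] scaleR_conv_of_real
          field_simps power2_eq_square)
    from this[of "K (z, w) y"] show ?thesis by (simp add: f_def indicator_def)
  qed
  have f_le: "norm (f y) \<le> indicator ?E y" for y
    by (simp add: f_def norm_mult indicator_def norm_sgn)
  have mix: "mixnorm_inf1 n \<alpha>1 \<alpha>2 f \<le> emeasure (dVa n \<alpha>2) D"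
  proof -
    have "mixnorm_inf1 n \<alpha>1 \<alpha>2 f \<le> (\<integral>\<^sup>+ \<eta>. indicator D \<eta> \<partial>dVa n \<alpha>2)"
      unfolding mixnorm_inf1_def
    proof (intro nn_integral_mono esssup_I AE_I2)
      fix \<eta> assume "\<eta> \<in> space (dVa n \<alpha>2)"
      then show "(\<lambda>u. ennreal (norm (f (u, \<eta>)))) \<in> borel_measurable (dVa n \<alpha>1)" by simp
      fix u
      have "ennreal (norm (f (u, \<eta>))) \<le> ennreal (indicator ?E (u, \<eta>))" using f_le by (intro ennreal_leI)
      also have "\<dots> \<le> indicator D \<eta>" by (auto simp: indicator_def)
      finally show "ennreal (norm (f (u, \<eta>))) \<le> indicator D \<eta>" .
    qed
    then show ?thesis using D(1) by simp
  qed
  have Dfin: "emeasure (dVa n \<alpha>) D < top" for \<alpha>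
    using emeasure_mono[OF D(2), of "dVa n \<alpha>"] emeasure_dVa_tube_box_finite[OF n, of \<alpha> l] by (auto intro: le_less_trans)
  \<comment> \<open>\<open>D\<close> has finite measure, so the bound is a real number and the limit
    can be taken with real inequalities.\<close>
  obtain B where B: "ennreal C * mixnorm_inf1 n \<alpha>1 \<alpha>2 f = ennreal B" "B \<ge> 0"
    using mix Dfin[of \<alpha>2] by (cases "ennreal C * mixnorm_inf1 n \<alpha>1 \<alpha>2 f")
      (auto simp: ennreal_mult_eq_top_iff top_unique)
  have "mixnorm_inf1 n \<alpha>1 \<alpha>2 f < \<infinity>" using le_less_trans[OF mix Dfin] by simp
  from bd[OF fm this] have ess: "esssup (dV2 n) (\<lambda>x. ennreal (norm (intop (prefac n a1 a2) K (dV2 n) f x))) \<le> ennreal B"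
    unfolding B(1) .
  have "AE x in dV2 n. ennreal (norm (intop (prefac n a1 a2) K (dV2 n) f x)) \<le> ennreal B"
    using esssup_AE[where M = "dV2 n" and f = "\<lambda>x. ennreal (norm (intop (prefac n a1 a2) K (dV2 n) f x))"]
    by (rule eventually_mono) (rule order_trans[OF _ ess])
  then have "AE x in dV2 n. norm (intop (prefac n a1 a2) K (dV2 n) f x) \<le> B"
    using B(2) by simp
  then obtain zs ws where s: "\<And>i. zs i \<in> tube n" "\<And>i. ws i \<in> tube n"
     "\<And>i. norm (intop (prefac n a1 a2) K (dV2 n) f (zs i, ws i)) \<le> B"
    "\<And>i j. j < n \<Longrightarrow> norm (zs i j - z j) \<le> 1" "\<And>i j. j < n \<Longrightarrow> norm (ws i j - w j) \<le> 1"
    "\<And>j. j < n \<Longrightarrow> (\<lambda>i. zs i j) \<longlonglongrightarrow> z j" "\<And>j. j < n \<Longrightarrow> (\<lambda>i. ws i j) \<longlonglongrightarrow> w j"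
    by (rule AE_dV2_near[OF _ z w]) blast
  obtain M where M: "\<And>z' w' u \<eta>. \<lbrakk>z' \<in> tube n; w' \<in> tube n; \<And>j. j < n \<Longrightarrow> norm (z' j - z j) \<le> 1;
    \<And>j. j < n \<Longrightarrow> norm (w' j - w j) \<le> 1; u \<in> tube_box n k; \<eta> \<in> tube_box n l\<rbrakk>
    \<Longrightarrow> norm (K (z', w') (u, \<eta>)) \<le> M"
    using K_bounded_near[OF z w, of k l] by blast
  have Efin: "emeasure (dV2 n) ?E < top"
    unfolding dV2_def using n D(1) Dfin[of 0] emeasure_dVa_tube_box_finite[OF n, of 0 k]
    by (subst sigma_finite_measure.emeasure_pair_measure_Times[OF sigma_finite_dVa[OF n]]) (auto simp: ennreal_mult_less_top)
  have dom: "norm (K (z', w') y * f y) \<le> \<bar>M\<bar> * indicator ?E y"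
    if "z' \<in> tube n" "w' \<in> tube n" "\<And>j. j < n \<Longrightarrow> norm (z' j - z j) \<le> 1" "\<And>j. j < n \<Longrightarrow> norm (w' j - w j) \<le> 1" for z' w' y
  proof (cases "y \<in> ?E")
    case True
    then obtain u \<eta> where y: "y = (u, \<eta>)" "u \<in> tube_box n k" "\<eta> \<in> tube_box n l" using D(2) by auto
    have "norm (K (z', w') y) * norm (f y) \<le> \<bar>M\<bar> * 1"
      using M[OF that y(2,3)] f_le[of y] True unfolding y(1) by (intro mult_mono) auto
    then show ?thesis using True by (simp add: norm_mult)
  qed (simp add: f_def)
  have domint: "integrable (dV2 n) (\<lambda>y. \<bar>M\<bar> * indicator ?E y)"
    using Efin by (intro integrable_mult_right integrable_real_indicator) auto
  have lim: "(\<lambda>i. LINT y|dV2 n. K (zs i, ws i) y * f y) \<longlonglongrightarrow> (LINT y|dV2 n. K (z, w) y * f y)"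
  proof (rule integral_dominated_convergence[where w = "\<lambda>y. \<bar>M\<bar> * indicator ?E y"])
    show "integrable (dV2 n) (\<lambda>y. \<bar>M\<bar> * indicator ?E y)" by fact
    show "(\<lambda>y. K (z, w) y * f y) \<in> borel_measurable (dV2 n)" by measurable
    show "(\<lambda>y. K (zs i, ws i) y * f y) \<in> borel_measurable (dV2 n)" for i
    proof -
      have [measurable]: "K (zs i, ws i) \<in> borel_measurable (lebC n \<Otimes>\<^sub>M lebC n)"
        using s(1,2)[of i] by (intro K_section_measurable) (auto simp: tube_eq space_pair_measure)
      show ?thesis by measurable
    qed
    show "AE y in dV2 n. (\<lambda>i. K (zs i, ws i) y * f y) \<longlonglongrightarrow> K (z, w) y * f y"
      using AE_dV2_tube
    proof eventually_elim
      fix y assume "fst y \<in> tube n \<and> snd y \<in> tube n"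
      then show "(\<lambda>i. K (zs i, ws i) y * f y) \<longlonglongrightarrow> K (z, w) y * f y"
        using K_tendsto[OF z w, of "fst y" "snd y" zs ws] s(6,7) by (intro tendsto_mult) auto
    qed
    show "AE y in dV2 n. norm (K (zs i, ws i) y * f y) \<le> \<bar>M\<bar> * indicator ?E y" for i
      using dom[OF s(1,2,4,5)] by auto
  qed
  have pos: "rho n z > 0" "rho n w > 0" using z w by (auto intro: rho_pos)
  have "(\<lambda>i. prefac n a1 a2 (zs i, ws i)) \<longlonglongrightarrow> prefac n a1 a2 (z, w)"
    unfolding prefac_def prod.case using pos tendsto_rho[OF n s(6)] tendsto_rho[OF n s(7)]
    by (intro tendsto_intros) auto
  from tendsto_norm[OF tendsto_mult[OF this lim]]
  have "norm (prefac n a1 a2 (z, w) * (LINT y|dV2 n. K (z, w) y * f y)) \<le> B"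
    by (rule LIMSEQ_le_const2) (use s(3) in \<open>auto simp: intop_def\<close>)
  also have "(LINT y|dV2 n. K (z, w) y * f y) = complex_of_real (LINT y|dV2 n. norm (K (z, w) y) * indicator ?E y)"
    unfolding Kf by (rule integral_complex_of_real)
  finally have le: "(rho n z powr a1 * rho n w powr a2) * (LINT y|dV2 n. norm (K (z, w) y) * indicator ?E y) \<le> B"
    by (simp add: prefac_def norm_mult)
  have "integrable (dV2 n) (\<lambda>y. norm (K (z, w) y) * indicator ?E y)"
  proof (rule Bochner_Integration.integrable_bound[OF domint])
    show "AE y in dV2 n. norm (norm (K (z, w) y) * indicator ?E y) \<le> norm (\<bar>M\<bar> * indicator ?E y)"
      using dom[OF z w] unfolding Kf by (auto simp: norm_mult)
  qed measurable
  then have "(\<integral>\<^sup>+ y. ennreal (norm (K (z, w) y) * indicator ?E y) \<partial>dV2 n) = ennreal (LINT y|dV2 n. norm (K (z, w) y) * indicator ?E y)"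
    by (intro nn_integral_eq_integral) auto
  moreover have "ennreal (norm (K (z, w) y) * indicator ?E y) = ennreal (norm (K (z, w) y)) * indicator ?E y" for y
    by (simp add: indicator_def)
  ultimately have "ennreal (rho n z powr a1 * rho n w powr a2) * (\<integral>\<^sup>+ y. ennreal (norm (K (z, w) y)) * indicator ?E y \<partial>dV2 n)
     = ennreal ((rho n z powr a1 * rho n w powr a2) * (LINT y|dV2 n. norm (K (z, w) y) * indicator ?E y))"
    by (simp add: ennreal_mult)
  also have "\<dots> \<le> ennreal B" using le by (rule ennreal_leI)
  also have "\<dots> \<le> ennreal C * emeasure (dVa n \<alpha>2) D"
    unfolding B(1)[symmetric] by (intro mult_left_mono mix) auto
  finally show ?thesis .
qed

text \<open>The modulus of the kernel is a product, so the double integral factors. The right-hand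
  side does not involve \<open>k\<close>, and monotone convergence along the boxes gives the full
  integral in \<open>u\<close>, which may still be infinite here. \<open>D\<close> stays arbitrary
  in order to localize in \<open>\<eta>\<close> later.\<close>

lemma kernel_product_le:
  assumes bd: "\<And>f. f \<in> borel_measurable (lebC n \<Otimes>\<^sub>M lebC n) \<Longrightarrow> mixnorm_inf1 n \<alpha>1 \<alpha>2 f < \<infinity> \<Longrightarrow>
      esssup (dV2 n) (\<lambda>x. ennreal (norm (intop (prefac n a1 a2) K (dV2 n) f x))) \<le> ennreal C * mixnorm_inf1 n \<alpha>1 \<alpha>2 f"
    and z: "z \<in> tube n" and w: "w \<in> tube n" and D: "D \<in> sets (lebC n)" "D \<subseteq> tube_box n l"
  shows "ennreal (rho n z powr a1) * (\<integral>\<^sup>+ u. ennreal (rho n u powr b1 * norm (rho2 n z u) powr (- c1)) \<partial>dVa n 0) *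
      (ennreal (rho n w powr a2) * (\<integral>\<^sup>+ \<eta>\<in>D. ennreal (rho n \<eta> powr b2 * norm (rho2 n w \<eta>) powr (- c2)) \<partial>dVa n 0))
     \<le> ennreal C * emeasure (dVa n \<alpha>2) D"
proof -
  let ?k1 = "\<lambda>u. ennreal (rho n u powr b1 * norm (rho2 n z u) powr (- c1))"
  let ?k2 = "\<lambda>\<eta>. ennreal (rho n \<eta> powr b2 * norm (rho2 n w \<eta>) powr (- c2))"
  let ?c = "ennreal (rho n z powr a1 * rho n w powr a2)"
  note D(1)[measurable]
  have Em[measurable]: "tube_box n k \<in> sets (lebC n)" for k using n by auto
  have sp[measurable]: "z \<in> space (lebC n)" "w \<in> space (lebC n)" using z w by (auto simp: tube_eq)
  have zw: "(z, w) \<in> space (lebC n \<Otimes>\<^sub>M lebC n)" using z w by (auto simp: tube_eq space_pair_measure)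
  have Kzw[measurable]: "K (z, w) \<in> borel_measurable (lebC n \<Otimes>\<^sub>M lebC n)" using zw by measurable
  have [measurable]: "?k1 \<in> borel_measurable (lebC n)" "?k2 \<in> borel_measurable (lebC n)" using n sp by measurable
  let ?Y = "\<integral>\<^sup>+ \<eta>\<in>D. ?k2 \<eta> \<partial>dVa n 0"
  let ?X = "\<lambda>k. \<integral>\<^sup>+ u\<in>tube_box n k. ?k1 u \<partial>dVa n 0"
  have split: "(\<integral>\<^sup>+ y. ennreal (norm (K (z, w) y)) * indicator (tube_box n k \<times> D) y \<partial>dV2 n) = ?X k * ?Y" for k
  proof -
    have "(\<integral>\<^sup>+ y. ennreal (norm (K (z, w) y)) * indicator (tube_box n k \<times> D) y \<partial>dV2 n)
       = (\<integral>\<^sup>+ \<eta>. \<integral>\<^sup>+ u. ennreal (norm (K (z, w) (u, \<eta>))) * indicator (tube_box n k \<times> D) (u, \<eta>) \<partial>dVa n 0 \<partial>dVa n 0)"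
      unfolding dV2_def by (rule dVa.nn_integral_snd[symmetric]) measurable
    also have "\<dots> = (\<integral>\<^sup>+ \<eta>. \<integral>\<^sup>+ u. (?k2 \<eta> * indicator D \<eta>) * (?k1 u * indicator (tube_box n k) u) \<partial>dVa n 0 \<partial>dVa n 0)"
    proof (intro nn_integral_cong)
      fix u \<eta>
      show "ennreal (norm (K (z, w) (u, \<eta>))) * indicator (tube_box n k \<times> D) (u, \<eta>)
         = (?k2 \<eta> * indicator D \<eta>) * (?k1 u * indicator (tube_box n k) u)"
      proof (cases "u \<in> tube_box n k \<and> \<eta> \<in> D")
        case True
        then have "u \<in> tube n" "\<eta> \<in> tube n" using tube_box_subset D(2) by blast+
        then show ?thesis using True by (simp add: norm_K z w ennreal_mult ac_simps)
      qed (auto simp: indicator_def)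
    qed
    also have "\<dots> = ?X k * ?Y"
      by (simp add: nn_integral_cmult nn_integral_multc mult.commute)
    finally show ?thesis .
  qed
  have J: "(\<integral>\<^sup>+ u. ?k1 u \<partial>dVa n 0) = (SUP k. ?X k)"
  proof -
    have "(SUP k. ?X k) = (\<integral>\<^sup>+ u. (SUP k. ?k1 u * indicator (tube_box n k) u) \<partial>dVa n 0)"
    proof (rule nn_integral_monotone_convergence_SUP[symmetric])
      show "incseq (\<lambda>k u. ?k1 u * indicator (tube_box n k) u)"
        using incseq_tube_box[of n] by (intro monoI le_funI mult_left_mono)
          (auto simp: incseq_def indicator_def dest: monoD)
    qed measurable
    also have "\<dots> = (\<integral>\<^sup>+ u. ?k1 u \<partial>dVa n 0)"
    proof (rule nn_integral_cong_AE, use AE_tube[of 0] in eventually_elim)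
      fix u assume "u \<in> tube n"
      then obtain k where "u \<in> tube_box n k" using UN_tube_box[of n] by blast
      then show "(SUP k. ?k1 u * indicator (tube_box n k) u) = ?k1 u"
        by (intro antisym SUP_least SUP_upper2[of k]) (auto simp: indicator_def)
    qed
    finally show ?thesis by simp
  qed
  have "ennreal (rho n z powr a1) * (SUP k. ?X k) * (ennreal (rho n w powr a2) * ?Y) = (SUP k. ?c * (?X k * ?Y))"
    by (simp add: SUP_mult_left_ennreal SUP_mult_right_ennreal[symmetric] ennreal_mult ac_simps)
  also have "\<dots> \<le> ennreal C * emeasure (dVa n \<alpha>2) D"
    using nn_integral_K_le[OF bd z w D] unfolding split by (intro SUP_least)
  finally show ?thesis unfolding J .
qed

end

text \<open>The point \<open>i t e_n\<close>. The restricted abstraction makes it extensional, hence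
  an element of the space of the product measure.\<close>

definition axis_point :: "nat \<Rightarrow> real \<Rightarrow> nat \<Rightarrow> complex" where
  "axis_point n t = (\<lambda>j\<in>{..<n}. if j = n - 1 then \<i> * t else 0)"

lemma axis_point_simps:
  "j < n - 1 \<Longrightarrow> axis_point n t j = 0"
  "n \<ge> 1 \<Longrightarrow> axis_point n t (n - 1) = \<i> * t"
  by (auto simp: axis_point_def)

lemma rho_axis_point: "n \<ge> 1 \<Longrightarrow> rho n (axis_point n t) = t"
  unfolding rho_def axis_point_simps(2) by (simp add: axis_point_simps(1))

lemma axis_point_in_tube: "n \<ge> 1 \<Longrightarrow> t > 0 \<Longrightarrow> axis_point n t \<in> tube n"
  by (simp add: tube_eq rho_axis_point) (simp add: axis_point_def lebC_def space_PiM)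

lemma norm_rho2_axis_point:
  assumes "n \<ge> 1" "s > 0" "t > 0"
  shows "norm (rho2 n (axis_point n s) (axis_point n t)) = (s + t) / 2"
proof -
  have "rho2 n (axis_point n s) (axis_point n t) = complex_of_real ((s + t) / 2)"
    unfolding rho2_def axis_point_simps(2)[OF assms(1)]
    by (simp add: axis_point_simps(1) algebra_simps add_divide_distrib)
  also have "norm \<dots> = (s + t) / 2" using assms(2,3) by (simp only: norm_of_real) simp
  finally show ?thesis .
qed

section \<open>From pointwise bounds to the exponents\<close>

context tube_kernel
begin

text \<open>An inequality between integrals over every small set \<open>D\<close> forces the
  inequality between the integrands almost everywhere. Passing from unweighted measure to
  \<open>dVa n \<alpha>2\<close> changes the exponent \<open>b2\<close> into
  \<open>b2 - \<alpha>2\<close>.\<close>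

lemma AE_kernel_le:
  assumes bd: "\<And>f. f \<in> borel_measurable (lebC n \<Otimes>\<^sub>M lebC n) \<Longrightarrow> mixnorm_inf1 n \<alpha>1 \<alpha>2 f < \<infinity> \<Longrightarrow>
      esssup (dV2 n) (\<lambda>x. ennreal (norm (intop (prefac n a1 a2) K (dV2 n) f x))) \<le> ennreal C * mixnorm_inf1 n \<alpha>1 \<alpha>2 f"
    and z: "z \<in> tube n" and w: "w \<in> tube n"
  shows "AE \<eta> in dVa n \<alpha>2. ennreal (rho n z powr a1) * (\<integral>\<^sup>+ u. ennreal (rho n u powr b1 * norm (rho2 n z u) powr (- c1)) \<partial>dVa n 0) *
      ennreal (rho n w powr a2 * rho n \<eta> powr (b2 - \<alpha>2) * norm (rho2 n w \<eta>) powr (- c2)) \<le> ennreal C"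
proof -
  define A where "A = ennreal (rho n z powr a1) * (\<integral>\<^sup>+ u. ennreal (rho n u powr b1 * norm (rho2 n z u) powr (- c1)) \<partial>dVa n 0)"
  define g where "g \<eta> = A * ennreal (rho n w powr a2 * rho n \<eta> powr (b2 - \<alpha>2) * norm (rho2 n w \<eta>) powr (- c2))" for \<eta>
  have sp[measurable]: "w \<in> space (lebC n)" using w by (auto simp: tube_eq)
  have gm[measurable]: "g \<in> borel_measurable (lebC n)" unfolding g_def using n by measurable
  have Em[measurable]: "tube_box n l \<in> sets (lebC n)" for l using n by auto
  have AEl: "AE \<eta> in dVa n \<alpha>2. \<eta> \<in> tube_box n l \<longrightarrow> g \<eta> \<le> ennreal C" for l
  proof (rule ccontr)
    assume contra: "\<not> ?thesis"
    \<comment> \<open>\<open>D\<close> is the set where the claim fails inside the box; on it the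
      integral of \<open>g\<close> is both at most and strictly more than that of the constant.
      Finiteness of the measure of \<open>D\<close> is what makes the strict comparison
      legitimate.\<close>
    define D where "D = {\<eta> \<in> space (lebC n). \<eta> \<in> tube_box n l \<and> ennreal C < g \<eta>}"
    have D[measurable]: "D \<in> sets (lebC n)" unfolding D_def by measurable
    have Dsub: "D \<subseteq> tube_box n l" by (auto simp: D_def)
    have "(\<integral>\<^sup>+ \<eta>. g \<eta> * indicator D \<eta> \<partial>dVa n \<alpha>2) = (\<integral>\<^sup>+ \<eta>. ennreal (rho n \<eta> powr \<alpha>2) * (g \<eta> * indicator D \<eta>) \<partial>dVa n 0)"
      by (rule nn_integral_dVa_shift[OF n]) measurable
    also have "\<dots> = (\<integral>\<^sup>+ \<eta>. A * ennreal (rho n w powr a2) * (ennreal (rho n \<eta> powr b2 * norm (rho2 n w \<eta>) powr (- c2)) * indicator D \<eta>) \<partial>dVa n 0)"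
    proof (rule nn_integral_cong_AE, use AE_tube[of 0] in eventually_elim)
      fix \<eta> assume "\<eta> \<in> tube n"
      then have p: "rho n \<eta> > 0" by (rule rho_pos)
      have "ennreal (rho n \<eta> powr \<alpha>2) * g \<eta> = A * ennreal (rho n w powr a2) * ennreal ((rho n \<eta> powr \<alpha>2 * rho n \<eta> powr (b2 - \<alpha>2)) * norm (rho2 n w \<eta>) powr (- c2))"
        by (simp add: g_def ennreal_mult ac_simps)
      also have "rho n \<eta> powr \<alpha>2 * rho n \<eta> powr (b2 - \<alpha>2) = rho n \<eta> powr b2"
        by (simp add: powr_add[symmetric])
      finally show "ennreal (rho n \<eta> powr \<alpha>2) * (g \<eta> * indicator D \<eta>) =
        A * ennreal (rho n w powr a2) * (ennreal (rho n \<eta> powr b2 * norm (rho2 n w \<eta>) powr (- c2)) * indicator D \<eta>)"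
        by (simp add: mult.assoc[symmetric])
    qed
    also have "\<dots> = A * (ennreal (rho n w powr a2) * (\<integral>\<^sup>+ \<eta>\<in>D. ennreal (rho n \<eta> powr b2 * norm (rho2 n w \<eta>) powr (- c2)) \<partial>dVa n 0))"
      using n by (subst nn_integral_cmult) (measurable, simp add: mult.assoc)
    also have "\<dots> \<le> ennreal C * emeasure (dVa n \<alpha>2) D"
      unfolding A_def by (rule kernel_product_le[OF bd z w D Dsub])
    finally have le: "(\<integral>\<^sup>+ \<eta>. g \<eta> * indicator D \<eta> \<partial>dVa n \<alpha>2) \<le> (\<integral>\<^sup>+ \<eta>. ennreal C * indicator D \<eta> \<partial>dVa n \<alpha>2)"
      by (simp add: nn_integral_cmult_indicator)
    have "emeasure (dVa n \<alpha>2) D < top"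
      using emeasure_mono[OF Dsub, of "dVa n \<alpha>2"] emeasure_dVa_tube_box_finite[OF n, of \<alpha>2 l] by (auto intro: le_less_trans)
    then have fin: "(\<integral>\<^sup>+ \<eta>. ennreal C * indicator D \<eta> \<partial>dVa n \<alpha>2) \<noteq> \<infinity>"
      by (simp add: nn_integral_cmult_indicator ennreal_mult_eq_top_iff)
    have "(\<integral>\<^sup>+ \<eta>. ennreal C * indicator D \<eta> \<partial>dVa n \<alpha>2) < (\<integral>\<^sup>+ \<eta>. g \<eta> * indicator D \<eta> \<partial>dVa n \<alpha>2)"
    proof (rule nn_integral_less[OF _ _ fin])
      show "AE \<eta> in dVa n \<alpha>2. ennreal C * indicator D \<eta> \<le> g \<eta> * indicator D \<eta>"
        by (auto simp: D_def indicator_def)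
      show "\<not> (AE \<eta> in dVa n \<alpha>2. g \<eta> * indicator D \<eta> \<le> ennreal C * indicator D \<eta>)"
      proof
        assume "AE \<eta> in dVa n \<alpha>2. g \<eta> * indicator D \<eta> \<le> ennreal C * indicator D \<eta>"
        then have "AE \<eta> in dVa n \<alpha>2. \<eta> \<in> tube_box n l \<longrightarrow> g \<eta> \<le> ennreal C"
          using AE_space
        proof eventually_elim
          case (elim \<eta>)
          then show ?case by (cases "\<eta> \<in> D") (auto simp: D_def)
        qed
        with contra show False by simp
      qed
    qed measurable
    with le show False by simp
  qed
  have "AE \<eta> in dVa n \<alpha>2. \<forall>l. \<eta> \<in> tube_box n l \<longrightarrow> g \<eta> \<le> ennreal C"
    by (subst AE_all_countable) (intro allI AEl)
  then have "AE \<eta> in dVa n \<alpha>2. g \<eta> \<le> ennreal C"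
    using AE_tube[of \<alpha>2] by eventually_elim (use UN_tube_box[of n] in blast)
  then show ?thesis unfolding g_def A_def .
qed

text \<open>First the constant \<open>H\<close> must be finite, which settles \<open>b1\<close> and
  a strict inequality for \<open>c1\<close>. Continuity then turns the almost-everywhere bound into
  a bound at every point, and evaluation at axis points leaves an inequality in three free positive
  parameters.\<close>

lemma bounded_imp:
  assumes "bounded_inf1_to_inf n \<alpha>1 \<alpha>2 (prefac n a1 a2) K"
  shows "a1 > 0 \<and> a2 \<ge> 0 \<and> b1 > -1 \<and> b2 \<ge> \<alpha>2 \<and> c1 = real n + 1 + a1 + b1 \<and> c2 = a2 + b2 - \<alpha>2"
proof -
  obtain C where bd: "\<And>f. f \<in> borel_measurable (lebC n \<Otimes>\<^sub>M lebC n) \<Longrightarrow> mixnorm_inf1 n \<alpha>1 \<alpha>2 f < \<infinity> \<Longrightarrow>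
      esssup (dV2 n) (\<lambda>x. ennreal (norm (intop (prefac n a1 a2) K (dV2 n) f x))) \<le> ennreal C * mixnorm_inf1 n \<alpha>1 \<alpha>2 f"
    using assms unfolding bounded_inf1_to_inf_def by blast
  obtain H where H: "H > 0" "H < top \<longleftrightarrow> b1 > -1 \<and> c1 > real n + 1 + b1"
    "\<And>z. z \<in> tube n \<Longrightarrow> (\<integral>\<^sup>+ u. ennreal (rho n u powr b1 * norm (rho2 n z u) powr (- c1)) \<partial>dVa n 0)
       = H * ennreal (rho n z powr (real n + 1 + b1 - c1))"
    using nn_integral_rho2_powr[OF n, where b = b1 and c = c1] by blast
  \<comment> \<open>The total exponent of \<open>rho n z\<close>, from the prefactor and from the
    integral in \<open>u\<close>. Once \<open>e = 0\<close> is known,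
    \<open>c1 > real n + 1 + b1\<close> gives \<open>a1 > 0\<close>.\<close>
  define e where "e = a1 + (real n + 1 + b1 - c1)"
  define W where "W w \<eta> = rho n w powr a2 * rho n \<eta> powr (b2 - \<alpha>2) * norm (rho2 n w \<eta>) powr (- c2)" for w \<eta>
  have ae: "AE \<eta> in dVa n \<alpha>2. H * ennreal (rho n z powr e * W w \<eta>) \<le> ennreal C" if zw: "z \<in> tube n" "w \<in> tube n" for z w
  proof -
    have "ennreal (rho n z powr a1) * (H * ennreal (rho n z powr (real n + 1 + b1 - c1))) * ennreal (W w \<eta>)
        = H * ennreal (rho n z powr e * W w \<eta>)" for \<eta>
      using zw by (simp add: e_def powr_add ennreal_mult W_def ac_simps)
    then show ?thesis using AE_kernel_le[OF bd zw] unfolding H(3)[OF zw(1)] W_def[symmetric] by simp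
  qed
  have Wpos: "W w \<eta> > 0" if "w \<in> tube n" "\<eta> \<in> tube n" for w \<eta>
    using rho_pos[OF that(1)] rho_pos[OF that(2)] rho2_nonzero[OF that] by (simp add: W_def)
  have o: "axis_point n 1 \<in> tube n" using n by (intro axis_point_in_tube) auto
  \<comment> \<open>An infinite \<open>H\<close> times a positive number could not stay below
    \<open>ennreal C\<close>; one good point suffices.\<close>
  have "H < top"
  proof -
    obtain \<eta> where \<eta>: "\<eta> \<in> tube n" "H * ennreal (rho n (axis_point n 1) powr e * W (axis_point n 1) \<eta>) \<le> ennreal C"
      using AE_dVa_near[OF n ae[OF o o] o zero_less_one] by blast
    then have "H * ennreal (rho n (axis_point n 1) powr e * W (axis_point n 1) \<eta>) < top"
      using ennreal_less_top le_less_trans by blast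
    then show ?thesis
      using Wpos[OF o \<eta>(1)] n by (auto simp: ennreal_mult_less_top rho_axis_point)
  qed
  then obtain h where h: "H = ennreal h" "h > 0" using H(1) by (cases H) auto
  \<comment> \<open>The absolute value covers a negative \<open>C\<close>, for which
    \<open>ennreal C\<close> is 0.\<close>
  have le: "rho n z powr e * W w \<eta> \<le> \<bar>C\<bar> / h" if zwh: "z \<in> tube n" "w \<in> tube n" "\<eta> \<in> tube n" for z w \<eta>
  proof -
    have "\<exists>\<eta>'. rho n z powr e * W w \<eta>' \<le> \<bar>C\<bar> / h \<and> (\<forall>j<n. norm (\<eta>' j - \<eta> j) < 1 / real (Suc i))" for i
    proof -
      have p: "1 / real (Suc i) > 0" by simp
      obtain \<eta>' where \<eta>': "\<eta>' \<in> tube n" "H * ennreal (rho n z powr e * W w \<eta>') \<le> ennreal C"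
          "\<And>j. j < n \<Longrightarrow> norm (\<eta>' j - \<eta> j) < 1 / real (Suc i)"
        using AE_dVa_near[OF n ae[OF zwh(1,2)] zwh(3) p] by blast
      have "ennreal (h * (rho n z powr e * W w \<eta>')) = H * ennreal (rho n z powr e * W w \<eta>')"
        using h Wpos[OF zwh(2) \<eta>'(1)] by (simp add: ennreal_mult)
      also have "\<dots> \<le> ennreal \<bar>C\<bar>" using \<eta>'(2) by (rule order_trans) (simp add: ennreal_leI)
      finally have "h * (rho n z powr e * W w \<eta>') \<le> \<bar>C\<bar>" by simp
      then have "rho n z powr e * W w \<eta>' \<le> \<bar>C\<bar> / h" using h(2) by (simp add: field_simps)
      then show ?thesis using \<eta>'(3) by blast
    qed
    then obtain hs where hs: "\<And>i. rho n z powr e * W w (hs i) \<le> \<bar>C\<bar> / h"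
        "\<And>i j. j < n \<Longrightarrow> norm (hs i j - \<eta> j) < 1 / real (Suc i)" by metis
    have lim: "(\<lambda>i. hs i j) \<longlonglongrightarrow> \<eta> j" if "j < n" for j
      by (rule LIMSEQ_if_norm_less[of _ _ 1]) (use hs(2)[OF that] in simp)
    have "(\<lambda>i. rho n (hs i)) \<longlonglongrightarrow> rho n \<eta>" by (rule tendsto_rho[OF n lim])
    moreover have "(\<lambda>i. rho2 n w (hs i)) \<longlonglongrightarrow> rho2 n w \<eta>" by (rule tendsto_rho2[OF n tendsto_const lim])
    ultimately have "(\<lambda>i. rho n z powr e * W w (hs i)) \<longlonglongrightarrow> rho n z powr e * W w \<eta>"
      unfolding W_def using rho_pos[OF zwh(3)] rho2_nonzero[OF zwh(2,3)] by (intro tendsto_intros) auto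
    then show ?thesis using hs(1) by (intro LIMSEQ_le_const2) auto
  qed
  have le_axis: "r powr e * (s powr a2 * t powr (b2 - \<alpha>2) * ((s + t) / 2) powr (- c2)) \<le> \<bar>C\<bar> / h"
    if "r > 0" "s > 0" "t > 0" for r s t
    using le[of "axis_point n r" "axis_point n s" "axis_point n t"] that n
    by (simp add: W_def axis_point_in_tube rho_axis_point norm_rho2_axis_point)
  \<comment> \<open>Putting \<open>s = t = 1\<close> leaves \<open>r powr e\<close>, bounded for all
    \<open>r > 0\<close>.\<close>
  have "e = 0"
    using le_axis[of _ 1 1] by (intro powr_bounded_imp_zero[of e "\<bar>C\<bar> / h"]) simp
  \<comment> \<open>On the diagonal \<open>s = t\<close> with \<open>r = 1\<close> everything
    collapses to a single power of \<open>t\<close>, bounded on the whole half-line.\<close>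
  moreover have "a2 + (b2 - \<alpha>2) - c2 = 0"
  proof (rule powr_bounded_imp_zero)
    fix t :: real assume "t > 0"
    then show "t powr (a2 + (b2 - \<alpha>2) - c2) \<le> \<bar>C\<bar> / h"
      using le_axis[of 1 t t] by (simp add: powr_add powr_diff powr_minus field_simps)
  qed
  moreover have "a2 \<ge> 0" "b2 - \<alpha>2 \<ge> 0"
  proof -
    \<comment> \<open>A positive lower bound for \<open>((1 + t) / 2) powr (- c2)\<close> on
      \<open>0 < t \<le> 1\<close>. With it, letting \<open>s\<close> or \<open>t\<close> alone tend
      to 0 isolates the powers \<open>a2\<close> and \<open>b2 - \<alpha>2\<close>.\<close>
    define d where "d = 2 powr c2 * min 1 (2 powr (- c2))"
    have d: "d > 0" by (simp add: d_def)
    have ge: "d \<le> ((1 + t) / 2) powr (- c2)" if "0 < t" "t \<le> 1" for t :: real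
    proof -
      have "d \<le> 2 powr c2 * (1 + t) powr (- c2)"
        unfolding d_def using that by (intro mult_left_mono powr_between_1_2) auto
      also have "\<dots> = ((1 + t) / 2) powr (- c2)"
        using that by (simp add: powr_divide powr_minus field_simps)
      finally show ?thesis .
    qed
    have *: "t powr p \<le> \<bar>C\<bar> / h / d" if t: "0 < t" "t \<le> 1" and "t powr p * ((1 + t) / 2) powr (- c2) \<le> \<bar>C\<bar> / h" for t p
    proof -
      have "t powr p * d \<le> \<bar>C\<bar> / h"
        using mult_left_mono[OF ge[OF t], of "t powr p"] that(3) by simp
      then show ?thesis using d by (simp only: pos_le_divide_eq)
    qed
    show "a2 \<ge> 0"
      using le_axis[of 1 _ 1] by (intro powr_bounded_near_0[of a2 "\<bar>C\<bar> / h / d"] *) (auto simp: add.commute)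
    show "b2 - \<alpha>2 \<ge> 0"
      using le_axis[of 1 1] by (intro powr_bounded_near_0[of "b2 - \<alpha>2" "\<bar>C\<bar> / h / d"] *) auto
  qed
  moreover have "b1 > -1" "c1 > real n + 1 + b1" using H(2) \<open>H < top\<close> by auto
  ultimately show ?thesis by (auto simp: e_def)
qed

lemma bounded_iff:
  "bounded_inf1_to_inf n \<alpha>1 \<alpha>2 (prefac n a1 a2) K \<longleftrightarrow>
    (a1 > 0 \<and> a2 \<ge> 0 \<and> b1 > -1 \<and> b2 \<ge> \<alpha>2 \<and> c1 = real n + 1 + a1 + b1 \<and> c2 = a2 + b2 - \<alpha>2)"
  using bounded_imp bounded_if by blast

end

theorem theorem6p11:
  fixes n :: nat and a1 a2 b1 b2 c1 c2 \<alpha>1 \<alpha>2 :: real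
  assumes "n \<ge> 1" and "\<alpha>1 > -1" and "\<alpha>2 > -1"
  shows "(bounded_inf1_to_inf n \<alpha>1 \<alpha>2 (prefac n a1 a2) (kerS n b1 b2 c1 c2)
            \<longleftrightarrow> bounded_inf1_to_inf n \<alpha>1 \<alpha>2 (prefac n a1 a2) (kerT n b1 b2 c1 c2))
       \<and> (bounded_inf1_to_inf n \<alpha>1 \<alpha>2 (prefac n a1 a2) (kerT n b1 b2 c1 c2)
            \<longleftrightarrow> (a1 > 0 \<and> a2 \<ge> 0 \<and> b1 > -1 \<and> b2 \<ge> \<alpha>2 \<and>
                 c1 = real n + 1 + a1 + b1 \<and> c2 = a2 + b2 - \<alpha>2))"
  \<comment> \<open>The criterion does not mention the kernel, so both operators reduce to the same
    condition on the exponents.\<close>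
  unfolding tube_kernel.bounded_iff[OF tube_kernel_kerS[OF assms(1)]]
    tube_kernel.bounded_iff[OF tube_kernel_kerT[OF assms(1)]] by blast

end
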